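(* There exist constants $0 < a_- < a^+ < \infty$ (depending on $\mu$ and the interval $[c_-,c^+]$) such that, for the spatial queue process started from any initial distribution, \[ a_- j^{-1/2} \le \rho_-(j) \le \rho^+(j) \le a^+ j^{-1/2} \quad \text{for all integers } j \ge 1, \] where \[ \rho^+(j) = \limsup_{\tau \to \infty} \tau^{-1} \sum_{t=1}^\tau \mathbb{P}(W(t) > j), \qquad \rho_-(j) = \liminf_{\tau \to \infty} \tau^{-1} \sum_{t=1}^\tau \mathbb{P}(W(t) > j). \]
   Context: Fix $0<c_-<c^+<\infty$ and a probability measure $\mu$ on $[c_-,c^+]$ with mean $1$ and variance $\sigma^2\in(0,\infty)$. A configuration is a sequence $\mathbf{x}=(x_0,x_1,x_2,\ldots)$ with $0=x_0<x_1<x_2<\cdots$ and $x_i-x_{i-1}\in[c_-,c^+]$ for all $i\ge 1$; $\mathbb{X}$ is the set of configurations. Let $(\xi_i(t),\ i\ge1,\ t\ge1)$ be i.i.d. with distribution $\mu$. The spatial queue process is the $\mathbb{X}$-valued Markov chain $\mathbf{X}(t)=(X_0(t),X_1(t),\ldots)$, $t=0,1,2,\ldots$, started from an arbitrary (possibly random, independent of the $\xi_i(t)$) initial configuration $\mathbf{X}(0)$ and defined inductively for $t\ge1$ by $X_0(t)=0$ and \[ W(t)=\min\{i\ge1:\ \xi_1(t)+\cdots+\xi_{i-1}(t)\ge X_{i+1}(t-1)-c^+\}, \] \[ X_i(t)=\xi_1(t)+\cdots+\xi_i(t)\ \ (1\le i<W(t)),\qquad X_i(t)=X_{i+1}(t-1)\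 \ (i\ge W(t)), \] where an empty sum is $0$ and $\min\emptyset=\infty$. $W(t)$ is called the wave length at step $t$. *)

theory Defs
  imports "HOL-Probability.Probability"
begin

definition configurations :: "real \<Rightarrow> real \<Rightarrow> (nat \<Rightarrow> real) set" where
  "configurations cm cp =
     {x. x 0 = 0 \<and> (\<forall>i. x i < x (Suc i)) \<and> (\<forall>i\<ge>1. x i - x (i - 1) \<in> {cm..cp})}"

text \<open>
  The argument \<open>\<xi>\<close> below is the family of fresh spacings used in a single step, so \<open>\<xi> i\<close> is
  meaningful for \<open>i \<ge> 1\<close> only. The infimum in \<^typ>\<open>enat\<close> is the minimum of a nonempty set, and
  it is \<open>\<infinity>\<close> for the empty set.
\<close>

definition step_wave_length :: "real \<Rightarrow> (nat \<Rightarrow> real) \<Rightarrow> (nat \<Rightarrow> real) \<Rightarrow> enat" where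
  "step_wave_length cp \<xi> x = Inf {enat i |i. 1 \<le> i \<and> (\<Sum>k=1..<i. \<xi> k) \<ge> x (i + 1) - cp}"

definition queue_step :: "real \<Rightarrow> (nat \<Rightarrow> real) \<Rightarrow> (nat \<Rightarrow> real) \<Rightarrow> (nat \<Rightarrow> real)" where
  "queue_step cp \<xi> x =
     (\<lambda>i. if i = 0 then 0
          else if enat i < step_wave_length cp \<xi> x then \<Sum>k=1..i. \<xi> k
          else x (i + 1))"

text \<open>
  The spatial queue process and its wave lengths, as functions of an outcome \<open>(x, \<xi>)\<close>: the initial
  configuration \<open>x\<close> and the array \<open>\<xi> (i, t)\<close>, \<open>i, t \<ge> 1\<close>. The wave length is meaningful for
  \<open>t \<ge> 1\<close> only.
\<close>

primrec spatial_queue ::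
    "real \<Rightarrow> nat \<Rightarrow> (nat \<Rightarrow> real) \<times> (nat \<times> nat \<Rightarrow> real) \<Rightarrow> (nat \<Rightarrow> real)" where
  "spatial_queue cp 0 \<omega> = fst \<omega>"
| "spatial_queue cp (Suc t) \<omega> = queue_step cp (\<lambda>i. snd \<omega> (i, Suc t)) (spatial_queue cp t \<omega>)"

definition wave_length ::
    "real \<Rightarrow> nat \<Rightarrow> (nat \<Rightarrow> real) \<times> (nat \<times> nat \<Rightarrow> real) \<Rightarrow> enat" where
  "wave_length cp t \<omega> = step_wave_length cp (\<lambda>i. snd \<omega> (i, t)) (spatial_queue cp (t - 1) \<omega>)"

definition initial_distribution :: "real \<Rightarrow> real \<Rightarrow> (nat \<Rightarrow> real) measure \<Rightarrow> bool" where
  "initial_distribution cm cp \<nu> \<longleftrightarrow>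
     prob_space \<nu> \<and> sets \<nu> = sets (\<Pi>\<^sub>M i\<in>UNIV. (borel :: real measure)) \<and>
     (AE x in \<nu>. x \<in> configurations cm cp)"

text \<open>
  The joint law of the initial configuration (distribution \<open>\<nu>\<close>) and of an independent i.i.d. array
  with distribution \<open>\<mu>\<close>. Working on this canonical space, whose type is fixed, makes it possible
  to quantify over all initial distributions inside a formula.
\<close>

definition queue_space ::
    "real measure \<Rightarrow> (nat \<Rightarrow> real) measure \<Rightarrow> ((nat \<Rightarrow> real) \<times> (nat \<times> nat \<Rightarrow> real)) measure" where
  "queue_space \<mu> \<nu> = \<nu> \<Otimes>\<^sub>M (\<Pi>\<^sub>M p\<in>{1..} \<times> {1..}. \<mu>)"

definition mean_wave_tail ::
    "real \<Rightarrow> real measure \<Rightarrow> (nat \<Rightarrow> real) measure \<Rightarrow> nat \<Rightarrow> nat \<Rightarrow> real" where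
  "mean_wave_tail cp \<mu> \<nu> j \<tau> =
     (\<Sum>t=1..\<tau>. measure (queue_space \<mu> \<nu>)
                  {\<omega> \<in> space (queue_space \<mu> \<nu>). wave_length cp t \<omega> > enat j}) / real \<tau>"

definition rho_upper ::
    "real \<Rightarrow> real measure \<Rightarrow> (nat \<Rightarrow> real) measure \<Rightarrow> nat \<Rightarrow> ereal" where
  "rho_upper cp \<mu> \<nu> j = limsup (\<lambda>\<tau>. ereal (mean_wave_tail cp \<mu> \<nu> j \<tau>))"

definition rho_lower ::
    "real \<Rightarrow> real measure \<Rightarrow> (nat \<Rightarrow> real) measure \<Rightarrow> nat \<Rightarrow> ereal" where
  "rho_lower cp \<mu> \<nu> j = liminf (\<lambda>\<tau>. ereal (mean_wave_tail cp \<mu> \<nu> j \<tau>))"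

end

theory Submission
  imports Defs
begin

text \<open>
  Label the customer of rank \<open>i\<close> at time \<open>t\<close> by the column \<open>t + i\<close>; a customer who moves up one rank
  keeps the column. As a function of the column, the configuration at time \<open>t\<close> is a random walk
  that starts at \<open>0\<close> in column \<open>t\<close>, has the fresh spacings as steps, and merges with the
  configuration of time \<open>t - 1\<close> when the wave ends. The process is thus a system of coalescing
  random walks, one started per unit of time, and \<open>W(t) > j\<close> says that the walk started at time \<open>t\<close>
  makes \<open>j\<close> steps before it merges with an older one. Two consecutive walks start at distance at
  most \<open>cp\<close>, so the order \<open>j powr (-1/2)\<close> is that of the probability that a centred random walk
  started near \<open>0\<close> avoids \<open>0\<close> for \<open>j\<close> steps.

  The observable is the gap \<open>gap cp t i\<close>, the distance moved at time \<open>t\<close> by the customer who gets rank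
  \<open>i\<close>; it is zero once the wave has ended. Three facts carry the proof.

  \<^item> For fixed \<open>i\<close> the gaps telescope in \<open>t\<close> (\<open>sum_gap_le\<close>, \<open>sum_gap_ge\<close>), so their time average lies
    between \<open>cm\<close> and \<open>cp\<close>, up to a term that vanishes as time grows.

  \<^item> From column to column, the gap changes by the difference of two independent spacings, of mean
    \<open>0\<close> and variance \<open>2 v\<close>, unless one of the two walks merges in this step (\<open>gap_Suc_eq\<close>,
    \<open>moments_difference\<close>). In a merge the step may be biased, but it stays bounded by \<open>cp\<close>.

  \<^item> Every walk merges at most once and is the older neighbour of at most one walk in each column, so
    on average at most two biased steps occur per unit of time (\<open>sum_merges_le\<close>). The total bias is
    therefore of the same order as the initial gaps.

  Upper bound. Apply the drift of the concave function \<open>L\<^sup>2 - (max (L - d) 0)\<^sup>2\<close> of the gap with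
  \<open>L\<close> of order \<open>sqrt J\<close>. It starts at order \<open>L\<close>, the merges contribute order \<open>L\<close>, and each column in
  which the gap is positive and below \<open>L - cp\<close> costs \<open>2 v\<close>; larger gaps are rare because the mean
  gap is bounded. Hence the expected number of ranks below \<open>J\<close> reached by a wave is \<open>O(sqrt J)\<close> on time
  average (\<open>sum_expected_reaches_le\<close>), and since this tail decreases in the rank, the tail at \<open>J\<close> is
  \<open>O(1 / sqrt J)\<close>.

  Lower bound. The mean gap at rank \<open>j\<close> is at least \<open>cm\<close>, so it suffices that gaps beyond
  \<open>L = K * sqrt j\<close> contribute at most \<open>cm / 2\<close>: then waves reaching \<open>j\<close> have frequency at least
  \<open>cm / (2 * L)\<close>. The convex function \<open>huber L\<close>, quadratic up to \<open>L\<close> and linear beyond, bounds this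
  contribution by its expectation divided by \<open>L\<close>. Its drift consists of the variance, summed over
  the \<open>O(sqrt j)\<close> columns given by the upper bound, and of the merge bias. Merges below a constant
  rank \<open>m\<close> happen at bounded gaps and contribute a constant; merges beyond \<open>m\<close> contribute at most
  order \<open>L\<close> each, but by the upper bound their frequency is only \<open>O(1 / sqrt m)\<close>. First \<open>m\<close> and then \<open>K\<close> are
  chosen large.
\<close>

section \<open>Waves as coalescing walks\<close>

definition wave_reaches ::
    "real \<Rightarrow> nat \<Rightarrow> nat \<Rightarrow> (nat \<Rightarrow> real) \<times> (nat \<times> nat \<Rightarrow> real) \<Rightarrow> bool" where
  "wave_reaches cp t i \<omega> \<longleftrightarrow>
     (\<forall>k\<in>{1..i}. (\<Sum>l=1..<k. snd \<omega> (l, t)) < spatial_queue cp (t - 1) \<omega> (k + 1) - cp)"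

lemma less_step_wave_length_iff:
  "enat i < step_wave_length cp \<xi> x \<longleftrightarrow> (\<forall>k\<in>{1..i}. (\<Sum>l=1..<k. \<xi> l) < x (k + 1) - cp)"
proof -
  let ?S = "{enat i |i. 1 \<le> i \<and> (\<Sum>k=1..<i. \<xi> k) \<ge> x (i + 1) - cp}"
  have "Inf ?S \<le> enat i \<longleftrightarrow> (\<exists>y\<in>?S. y \<le> enat i)"
  proof
    assume *: "Inf ?S \<le> enat i"
    then have "?S \<noteq> {}" unfolding Inf_enat_def by (auto split: if_splits simp del: Collect_empty_eq)
    then have "Inf ?S \<in> ?S" by (metis (no_types, lifting) Inf_enat_def LeastI ex_in_conv)
    then show "\<exists>y\<in>?S. y \<le> enat i" by (rule bexI[rotated]) (rule *)
  next
    show "\<exists>y\<in>?S. y \<le> enat i \<Longrightarrow> Inf ?S \<le> enat i"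
      by (meson Inf_lower order_trans)
  qed
  also have "\<dots> \<longleftrightarrow> (\<exists>k\<in>{1..i}. (\<Sum>l=1..<k. \<xi> l) \<ge> x (k + 1) - cp)"
    by force
  finally show ?thesis
    unfolding step_wave_length_def by (metis (no_types, lifting) not_le)
qed

lemma wave_length_greater_iff: "enat i < wave_length cp t \<omega> \<longleftrightarrow> wave_reaches cp t i \<omega>"
  by (simp add: wave_length_def less_step_wave_length_iff wave_reaches_def)

lemma spatial_queue_Suc_eq:
  "spatial_queue cp (Suc t) \<omega> i =
     (if i = 0 then 0
      else if wave_reaches cp (Suc t) i \<omega> then \<Sum>k=1..i. snd \<omega> (k, Suc t)
      else spatial_queue cp t \<omega> (i + 1))"
  by (simp add: queue_step_def less_step_wave_length_iff wave_reaches_def)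

declare spatial_queue.simps(2) [simp del]

lemma wave_reaches_0 [simp]: "wave_reaches cp t 0 \<omega>"
  by (simp add: wave_reaches_def)

lemma wave_reaches_antimono: "wave_reaches cp t i \<omega> \<Longrightarrow> k \<le> i \<Longrightarrow> wave_reaches cp t k \<omega>"
  by (auto simp: wave_reaches_def)

lemma wave_reaches_Suc_iff:
  "wave_reaches cp t (Suc i) \<omega> \<longleftrightarrow> wave_reaches cp t i \<omega> \<and>
     (\<Sum>l=1..i. snd \<omega> (l, t)) < spatial_queue cp (t - 1) \<omega> (i + 2) - cp"
  by (auto simp: wave_reaches_def atLeastAtMostSuc_conv atLeastLessThanSuc_atLeastAtMost)

definition gap ::
    "real \<Rightarrow> nat \<Rightarrow> nat \<Rightarrow> (nat \<Rightarrow> real) \<times> (nat \<times> nat \<Rightarrow> real) \<Rightarrow> real" where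
  "gap cp t i \<omega> = spatial_queue cp (t - 1) \<omega> (i + 1) - spatial_queue cp t \<omega> i"

text \<open>
  The time at which the current position of the customer of rank \<open>i\<close> was created, that is, the walk
  which the configuration of time \<open>t\<close> follows in column \<open>t + i\<close>. The value \<open>0\<close> stands for the initial
  configuration.
\<close>

primrec origin ::
    "real \<Rightarrow> nat \<Rightarrow> nat \<Rightarrow> (nat \<Rightarrow> real) \<times> (nat \<times> nat \<Rightarrow> real) \<Rightarrow> nat" where
  "origin cp 0 i \<omega> = 0"
| "origin cp (Suc t) i \<omega> =
     (if wave_reaches cp (Suc t) i \<omega> then Suc t else origin cp t (Suc i) \<omega>)"

lemma origin_le: "origin cp t i \<omega> \<le> t"
  by (induction t arbitrary: i) (auto intro: le_SucI)

lemma wave_reaches_origin: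
  "wave_reaches cp (origin cp t i \<omega>) (t + i - origin cp t i \<omega>) \<omega> \<or> origin cp t i \<omega> = 0"
proof (induction t arbitrary: i)
  case (Suc t)
  then show ?case using Suc.IH[of "Suc i"] by (cases "wave_reaches cp (Suc t) i \<omega>") simp_all
qed simp

text \<open>
  A walk that is still separate in a column stops the search for the origin, which goes back in time.
\<close>

lemma origin_greatest:
  "wave_reaches cp s (t + i - s) \<omega> \<Longrightarrow> s \<le> t \<Longrightarrow> s \<le> origin cp t i \<omega>"
proof (induction t arbitrary: i)
  case (Suc t)
  show ?case
  proof (cases "wave_reaches cp (Suc t) i \<omega>")
    case False
    with Suc.prems have "s \<noteq> Suc t" by auto
    with Suc.prems have "s \<le> origin cp t (Suc i) \<omega>"
      by (intro Suc.IH) auto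
    then show ?thesis using False by simp
  qed (use Suc.prems in simp)
qed simp

text \<open>
  Customers only change rank, not position, between two waves that reach them, so positions are read
  off the walk of origin.
\<close>
lemma spatial_queue_origin:
  assumes "s = origin cp t i \<omega>" "i \<ge> 1"
  shows "spatial_queue cp t \<omega> i =
           (if s = 0 then fst \<omega> (t + i) else \<Sum>k=1..t + i - s. snd \<omega> (k, s))"
  using assms by (induction t arbitrary: i) (auto simp: spatial_queue_Suc_eq)

text \<open>
  If the walk that the configuration follows at rank \<open>i\<close> does not merge in the next column, the
  configuration follows it there too: a younger walk still separate in that column would have been
  separate in the previous one.
\<close>
lemma spatial_queue_Suc_origin:
  assumes "s = origin cp t i \<omega>" "s \<ge> 1" "i \<ge> 1" "wave_reaches cp s (t + i + 1 - s) \<omega>"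
  shows "spatial_queue cp t \<omega> (Suc i) = spatial_queue cp t \<omega> i + snd \<omega> (t + i + 1 - s, s)"
proof -
  have "s \<le> t" using assms(1) origin_le by simp
  have "s \<le> origin cp t (Suc i) \<omega>"
    using assms \<open>s \<le> t\<close> by (intro origin_greatest) auto
  moreover have "origin cp t (Suc i) \<omega> \<le> s"
  proof -
    let ?r = "origin cp t (Suc i) \<omega>"
    have "wave_reaches cp ?r (t + Suc i - ?r) \<omega>"
      using wave_reaches_origin[of cp t "Suc i" \<omega>] calculation assms(2) by auto
    then have "wave_reaches cp ?r (t + i - ?r) \<omega>"
      by (rule wave_reaches_antimono) simp
    then show ?thesis unfolding assms(1) by (intro origin_greatest origin_le)
  qed
  ultimately have s: "s = origin cp t (Suc i) \<omega>" by simp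
  have "spatial_queue cp t \<omega> (Suc i) = (\<Sum>k=1..t + Suc i - s. snd \<omega> (k, s))"
    using spatial_queue_origin[OF s] assms(2) by simp
  moreover have "t + Suc i - s = Suc (t + i - s)" using \<open>s \<le> t\<close> by simp
  moreover have "spatial_queue cp t \<omega> i = (\<Sum>k=1..t + i - s. snd \<omega> (k, s))"
    using spatial_queue_origin[OF assms(1,3)] assms(2) by simp
  ultimately show ?thesis by simp
qed

text \<open>
  The support conditions hold only almost surely. The locale collects the deterministic consequences
  for a single outcome which satisfies them.
\<close>

locale queue_path =
  fixes cm cp :: real and \<omega> :: "(nat \<Rightarrow> real) \<times> (nat \<times> nat \<Rightarrow> real)"
  assumes cm_pos: "0 < cm" and cm_less_cp: "cm < cp"
    and initial_configuration: "fst \<omega> \<in> configurations cm cp"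
    and spacing_mem: "i \<ge> 1 \<Longrightarrow> t \<ge> 1 \<Longrightarrow> snd \<omega> (i, t) \<in> {cm..cp}"
begin

abbreviation X where "X t i \<equiv> spatial_queue cp t \<omega> i"
abbreviation D where "D t i \<equiv> gap cp t i \<omega>"

lemma cp_pos: "0 < cp"
  using cm_pos cm_less_cp by simp

lemma initial_increment: "fst \<omega> (Suc i) - fst \<omega> i \<in> {cm..cp}"
  using initial_configuration unfolding configurations_def by (auto dest!: spec[of _ "Suc i"])

lemma initial_0: "fst \<omega> 0 = 0"
  using initial_configuration unfolding configurations_def by simp

lemma X_0 [simp]: "X t 0 = 0"
  by (cases t) (simp_all add: initial_0 spatial_queue_Suc_eq)

text \<open>
  Customers never move away from the head of the queue: the wave stops as soon as a customer could
  follow the previous one at distance \<open>cp\<close> without moving, hence one step earlier the fresh position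
  is still ahead of the old one.
\<close>
lemma fresh_sum_le:
  assumes "wave_reaches cp t i \<omega>" "t \<ge> 1" "i \<ge> 1"
  shows "(\<Sum>k=1..i. snd \<omega> (k, t)) \<le> X (t - 1) (Suc i)"
proof -
  obtain j where i: "i = Suc j" using assms(3) by (cases i) auto
  have "(\<Sum>k=1..j. snd \<omega> (k, t)) < X (t - 1) (Suc i) - cp"
    using assms(1) by (simp add: i wave_reaches_Suc_iff)
  moreover have "snd \<omega> (Suc j, t) \<le> cp"
    using spacing_mem[of "Suc j" t] assms(2) by simp
  ultimately show ?thesis by (simp add: i)
qed

lemma X_increment: "X t (Suc i) - X t i \<in> {cm..cp}"
proof (induction t arbitrary: i)
  case 0
  then show ?case using initial_increment by simp
next
  case (Suc t)
  let ?S = "\<Sum>k=1..i. snd \<omega> (k, Suc t)"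
  consider "wave_reaches cp (Suc t) (Suc i) \<omega>"
    | "wave_reaches cp (Suc t) i \<omega>" "\<not> wave_reaches cp (Suc t) (Suc i) \<omega>"
    | "\<not> wave_reaches cp (Suc t) i \<omega>" "\<not> wave_reaches cp (Suc t) (Suc i) \<omega>"
    using wave_reaches_antimono[of cp "Suc t" "Suc i" \<omega> i] by auto
  then show ?case
  proof cases
    case 1
    then have "X (Suc t) (Suc i) - X (Suc t) i = snd \<omega> (Suc i, Suc t)"
      using wave_reaches_antimono[of cp "Suc t" "Suc i" \<omega> i] by (simp add: spatial_queue_Suc_eq)
    then show ?thesis using spacing_mem[of "Suc i" "Suc t"] by simp
  next
    \<comment> \<open>The wave ends at rank \<open>i + 1\<close>: the stopping rule bounds the new spacing above, monotonicity below.\<close>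
    case 2
    have X': "X (Suc t) i = ?S" "X (Suc t) (Suc i) = X t (Suc (Suc i))"
      using 2 by (auto simp: spatial_queue_Suc_eq)
    have "?S \<le> X t (Suc i)"
      using fresh_sum_le[of "Suc t" i] 2(1) Suc.IH[of 0] cm_pos
      by (cases "i = 0") auto
    moreover have "?S \<ge> X t (Suc (Suc i)) - cp"
      using 2 by (auto simp: wave_reaches_Suc_iff)
    ultimately show ?thesis
      using Suc.IH[of "Suc i"] by (simp add: X')
  next
    case 3
    moreover have "i \<noteq> 0" using 3 by (auto intro: ccontr)
    ultimately show ?thesis using Suc.IH[of "Suc i"] by (simp add: spatial_queue_Suc_eq)
  qed
qed

lemma X_bounds: "real i * cm \<le> X t i" "X t i \<le> real i * cp"
proof -
  have "real i * cm \<le> X t i \<and> X t i \<le> real i * cp"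
  proof (induction i)
    case (Suc i)
    then show ?case using X_increment[of t i] by (auto simp: algebra_simps)
  qed simp
  then show "real i * cm \<le> X t i" "X t i \<le> real i * cp" by auto
qed

lemma gap_eq_0: "\<not> wave_reaches cp t i \<omega> \<Longrightarrow> t \<ge> 1 \<Longrightarrow> D t i = 0"
  by (cases t; cases "i = 0") (auto simp: gap_def spatial_queue_Suc_eq)

lemma gap_nonneg:
  assumes "t \<ge> 1" shows "0 \<le> D t i"
proof (cases "wave_reaches cp t i \<omega> \<and> i \<ge> 1")
  case True
  then show ?thesis using assms fresh_sum_le[of t i]
    by (cases t) (auto simp: gap_def spatial_queue_Suc_eq)
next
  case False
  then show ?thesis
    using gap_eq_0[OF _ assms, of i] X_bounds(1)[of "Suc 0" "t - 1"] cm_pos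
    by (cases "i = 0") (auto simp: gap_def)
qed

lemma gap_le: "t \<ge> 1 \<Longrightarrow> D t i \<le> real (Suc i) * cp"
  using X_bounds(2)[where i = "Suc i" and t = "t - 1"] X_bounds(1)[where i = i and t = t] cm_pos
  by (simp add: gap_def) (smt (verit) mult_nonneg_nonneg of_nat_0_le_iff)

text \<open>
  This bound includes the steps in which walks merge, which is why merges need no separate control
  of their size.
\<close>

lemma gap_increment: "\<bar>D t (Suc i) - D t i\<bar> \<le> cp"
  using X_increment[of "t - 1" "Suc i"] X_increment[of t i] cm_pos
  unfolding gap_def abs_le_iff atLeastAtMost_iff add_Suc_right add_0_right One_nat_def by linarith

text \<open>
  The movements into rank \<open>i\<close> add up to spacings between ranks \<open>i\<close> and \<open>i + 1\<close>, apart from the two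
  boundary configurations.
\<close>

lemma sum_gap_eq:
  "(\<Sum>t=1..\<tau>. D t i) = (\<Sum>t=1..\<tau>. X (t - 1) (Suc i) - X (t - 1) i) + X 0 i - X \<tau> i"
  by (induction \<tau>) (auto simp: gap_def)

lemma sum_gap_le: "(\<Sum>t=1..\<tau>. D t i) \<le> cp * (real \<tau> + real i)"
proof -
  have "(\<Sum>t=1..\<tau>. X (t - 1) (Suc i) - X (t - 1) i) \<le> real (card {1..\<tau>}) * cp"
    using X_increment by (intro sum_bounded_above) auto
  moreover have "0 \<le> X \<tau> i" using X_bounds(1)[where i = i and t = \<tau>] cm_pos
    by (smt (verit) mult_nonneg_nonneg of_nat_0_le_iff)
  ultimately show ?thesis
    using X_bounds(2)[where i = i and t = 0] unfolding sum_gap_eq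
    by (simp add: algebra_simps)
qed

lemma sum_gap_ge: "cm * real \<tau> - cp * real i \<le> (\<Sum>t=1..\<tau>. D t i)"
proof -
  have "real (card {1..\<tau>}) * cm \<le> (\<Sum>t=1..\<tau>. X (t - 1) (Suc i) - X (t - 1) i)"
    using X_increment by (intro sum_bounded_below) auto
  moreover have "0 \<le> X 0 i" using X_bounds(1)[where i = i and t = 0] cm_pos
    by (smt (verit) mult_nonneg_nonneg of_nat_0_le_iff)
  ultimately show ?thesis
    using X_bounds(2)[where i = i and t = \<tau>] unfolding sum_gap_eq
    by (simp add: algebra_simps)
qed

text \<open>
  The initial configuration leaves the first \<open>i\<close> ranks after a time linear in \<open>i\<close>: customer \<open>t + i\<close>
  starts at distance at least \<open>(t + i) * cm\<close>, and rank \<open>i\<close> is within distance \<open>i * cp\<close>. This removes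
  the influence of the arbitrary initial distribution.
\<close>
lemma origin_pos:
  assumes "real t * cm > real i * cp" "i \<ge> 1"
  shows "origin cp t i \<omega> \<ge> 1"
proof (rule ccontr)
  assume "\<not> origin cp t i \<omega> \<ge> 1"
  then have "X t i = X 0 (t + i)"
    using assms(2) by (auto simp: spatial_queue_origin)
  then have "real (t + i) * cm \<le> real i * cp"
    using X_bounds(1)[of "t + i" 0] X_bounds(2)[of t i] by simp
  moreover have "0 \<le> real i * cm" using cm_pos by simp
  ultimately show False using assms(1) by (simp add: algebra_simps)
qed

end

section \<open>Free steps and merges\<close>

text \<open>
  The walk against which \<open>gap cp t i\<close> is measured: the older neighbour, in column \<open>t + i\<close>, of the
  walk started at time \<open>t\<close>.
\<close>

definition leader :: "real \<Rightarrow> nat \<Rightarrow> nat \<Rightarrow> (nat \<Rightarrow> real) \<times> (nat \<times> nat \<Rightarrow> real) \<Rightarrow> nat" where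
  "leader cp t i \<omega> = origin cp (t - 1) (Suc i) \<omega>"

text \<open>
  Two neighbouring walks in column \<open>t + i\<close>, both made of fresh spacings. The leader must not be the
  initial configuration, whose increments are not random walk steps.
\<close>

definition free_walks :: "real \<Rightarrow> nat \<Rightarrow> nat \<Rightarrow> (nat \<Rightarrow> real) \<times> (nat \<times> nat \<Rightarrow> real) \<Rightarrow> bool" where
  "free_walks cp t i \<omega> \<longleftrightarrow> wave_reaches cp t i \<omega> \<and> leader cp t i \<omega> \<ge> 1"

text \<open>
  The change of the gap in the next column if neither walk merges. Both spacings lie in column
  \<open>t + i + 1\<close>, so they are independent of everything up to column \<open>t + i\<close>.
\<close>

definition free_increment :: "real \<Rightarrow> nat \<Rightarrow> nat \<Rightarrow> (nat \<Rightarrow> real) \<times> (nat \<times> nat \<Rightarrow> real) \<Rightarrow> real" where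
  "free_increment cp t i \<omega> =
     snd \<omega> (t + i + 1 - leader cp t i \<omega>, leader cp t i \<omega>) - snd \<omega> (i + 1, t)"

definition merges :: "real \<Rightarrow> nat \<Rightarrow> nat \<Rightarrow> (nat \<Rightarrow> real) \<times> (nat \<times> nat \<Rightarrow> real) \<Rightarrow> bool" where
  "merges cp t i \<omega> \<longleftrightarrow>
     free_walks cp t i \<omega> \<and>
     (\<not> wave_reaches cp t (i + 1) \<omega> \<or>
      \<not> wave_reaches cp (leader cp t i \<omega>) (t + i + 1 - leader cp t i \<omega>) \<omega>)"

lemma leader_less: "t \<ge> 1 \<Longrightarrow> leader cp t i \<omega> < t"
  using origin_le[of cp "t - 1" "Suc i" \<omega>] by (simp add: leader_def)

lemma wave_reaches_leader:
  assumes "leader cp t i \<omega> \<ge> 1" "t \<ge> 1"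
  shows "wave_reaches cp (leader cp t i \<omega>) (t + i - leader cp t i \<omega>) \<omega>"
  using wave_reaches_origin[of cp "t - 1" "Suc i" \<omega>] assms by (auto simp: leader_def)

lemma leader_strict_mono:
  assumes "wave_reaches cp t i \<omega>" "t + i = t' + i'" "1 \<le> t" "t < t'"
  shows "leader cp t i \<omega> < leader cp t' i' \<omega>"
proof -
  have "t \<le> leader cp t' i' \<omega>"
  proof -
    have "t' - 1 + Suc i' - t = i" "t \<le> t' - 1" using assms by linarith+
    then show ?thesis unfolding leader_def using assms(1) by (intro origin_greatest) simp_all
  qed
  then show ?thesis using leader_less[OF assms(3)] by (rule order.strict_trans2[rotated])
qed

lemma sum_of_bool_Times:
  assumes "finite A" "finite B"
  shows "(\<Sum>a\<in>A. \<Sum>b\<in>B. of_bool (Q a b)) = real (card {(a, b). a \<in> A \<and> b \<in> B \<and> Q a b})"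
proof -
  have "(\<Sum>a\<in>A. \<Sum>b\<in>B. of_bool (Q a b)) = (\<Sum>p\<in>A \<times> B. of_bool (Q (fst p) (snd p)))"
    by (simp add: sum.cartesian_product case_prod_beta)
  also have "\<dots> = real (card (A \<times> B \<inter> {p. Q (fst p) (snd p)}))"
    using assms by (subst sum_of_bool_eq) auto
  also have "A \<times> B \<inter> {p. Q (fst p) (snd p)} = {(a, b). a \<in> A \<and> b \<in> B \<and> Q a b}"
    by auto
  finally show ?thesis .
qed

text \<open>
  A merge seen by the pair \<open>(t, i)\<close> is the end either of the walk \<open>t\<close> or of its leader. Charge it to the
  walk that ends. The charging is injective in both cases, as a walk ends in one column only and leads
  at most one walk in that column. The walk charged has made at least \<open>i \<ge> m\<close> steps; keeping track of
  \<open>m\<close> makes late merges rare.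
\<close>
lemma sum_merges_le:
  "(\<Sum>t=1..\<tau>. \<Sum>i=m..<J. of_bool (merges cp t i \<omega>))
     \<le> (2 * (\<Sum>t=1..\<tau>. of_bool (wave_reaches cp t m \<omega>)) :: real)"
proof -
  let ?C = "{t \<in> {1..\<tau>}. wave_reaches cp t m \<omega>}"
  let ?A = "{(t, i). t \<in> {1..\<tau>} \<and> i \<in> {m..<J} \<and>
               wave_reaches cp t i \<omega> \<and> \<not> wave_reaches cp t (Suc i) \<omega>}"
  let ?B = "{(t, i). t \<in> {1..\<tau>} \<and> i \<in> {m..<J} \<and> free_walks cp t i \<omega> \<and>
               \<not> wave_reaches cp (leader cp t i \<omega>) (t + i + 1 - leader cp t i \<omega>) \<omega>}"
  let ?M = "{(t, i). t \<in> {1..\<tau>} \<and> i \<in> {m..<J} \<and> merges cp t i \<omega>}"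
  have fin: "finite ?A" "finite ?B"
    by (rule finite_subset[of _ "{1..\<tau>} \<times> {m..<J}"]; auto)+
  have "card ?A \<le> card ?C"
  proof (rule card_inj_on_le)
    show "fst ` ?A \<subseteq> ?C" by (auto intro: wave_reaches_antimono)
    show "inj_on fst ?A"
    proof (clarsimp simp: inj_on_def)
      fix t i i'
      assume "wave_reaches cp t i \<omega>" "\<not> wave_reaches cp t (Suc i) \<omega>"
        and "wave_reaches cp t i' \<omega>" "\<not> wave_reaches cp t (Suc i') \<omega>"
      then show "i = i'"
        by (metis wave_reaches_antimono not_less_eq_eq linorder_le_cases le_antisym)
    qed
  qed simp
  moreover have "card ?B \<le> card ?C"
  proof (rule card_inj_on_le)
    let ?l = "\<lambda>(t, i). leader cp t i \<omega>"
    show "?l ` ?B \<subseteq> ?C"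
    proof clarsimp
      fix t i
      assume *: "Suc 0 \<le> t" "t \<le> \<tau>" "m \<le> i" "free_walks cp t i \<omega>"
      then have "wave_reaches cp (leader cp t i \<omega>) (t + i - leader cp t i \<omega>) \<omega>"
        by (intro wave_reaches_leader) (auto simp: free_walks_def)
      then show "Suc 0 \<le> leader cp t i \<omega> \<and> leader cp t i \<omega> \<le> \<tau> \<and> wave_reaches cp (leader cp t i \<omega>) m \<omega>"
        using * leader_less[of t cp i \<omega>] by (auto simp: free_walks_def elim!: wave_reaches_antimono)
    qed
    show "inj_on ?l ?B"
    proof (rule inj_onI)
      fix a a' assume "a \<in> ?B" "a' \<in> ?B" "?l a = ?l a'"
      then obtain t i t' i' where a: "a = (t, i)" "a' = (t', i')"
        and t: "1 \<le> t" and free: "free_walks cp t i \<omega>"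
        and end1: "\<not> wave_reaches cp (leader cp t i \<omega>) (t + i + 1 - leader cp t i \<omega>) \<omega>"
        and t': "1 \<le> t'" and free': "free_walks cp t' i' \<omega>"
        and end2: "\<not> wave_reaches cp (leader cp t' i' \<omega>) (t' + i' + 1 - leader cp t' i' \<omega>) \<omega>"
        and eq: "leader cp t i \<omega> = leader cp t' i' \<omega>"
        by auto
      let ?s = "leader cp t i \<omega>"
      have s: "wave_reaches cp ?s (t + i - ?s) \<omega>" "wave_reaches cp ?s (t' + i' - ?s) \<omega>"
        using wave_reaches_leader[of cp t i \<omega>] wave_reaches_leader[of cp t' i' \<omega>] t t' free free' eq
        by (auto simp: free_walks_def)
      \<comment> \<open>The common leader merges in one column only, so both pairs lie in that column.\<close>
      have le: "?s < t" "?s < t'" using leader_less[of t cp i \<omega>] leader_less[of t' cp i' \<omega>] t t' eq by auto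
      have "t + i = t' + i'"
      proof (rule ccontr)
        assume "t + i \<noteq> t' + i'"
        then consider "t + i + 1 - ?s \<le> t' + i' - ?s" | "t' + i' + 1 - ?s \<le> t + i - ?s"
          using le by linarith
        then show False
          using s end1 end2 eq by cases (auto dest: wave_reaches_antimono)
      qed
      moreover have "t = t'"
      proof (rule linorder_cases[of t t'])
        assume "t < t'"
        then show ?thesis
          using leader_strict_mono[of cp t i \<omega> t' i'] calculation t free eq
          by (simp add: free_walks_def)
      next
        assume "t' < t"
        then show ?thesis
          using leader_strict_mono[of cp t' i' \<omega> t i] calculation t' free' eq
          by (simp add: free_walks_def)
      qed
      ultimately show "a = a'" by (simp add: a)
    qed
  qed simp
  moreover have "card ?M \<le> card (?A \<union> ?B)"
    using fin by (intro card_mono) (auto simp: merges_def free_walks_def)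
  moreover have "card (?A \<union> ?B) \<le> card ?A + card ?B" by (rule card_Un_le)
  ultimately have "real (card ?M) \<le> real (2 * card ?C)" by linarith
  moreover have "(\<Sum>t=1..\<tau>. \<Sum>i=m..<J. of_bool (merges cp t i \<omega>)) = real (card ?M)"
    by (rule sum_of_bool_Times) auto
  moreover have "(\<Sum>t=1..\<tau>. of_bool (wave_reaches cp t m \<omega>)) = real (card ?C)"
    by (simp add: sum_of_bool_eq Int_def)
  ultimately show ?thesis by simp
qed

context queue_path begin

lemma gap_Suc_eq:
  assumes "t \<ge> 1" "free_walks cp t i \<omega>" "\<not> merges cp t i \<omega>"
  shows "D t (Suc i) = D t i + free_increment cp t i \<omega>"
proof -
  let ?s = "leader cp t i \<omega>"
  have *: "wave_reaches cp t i \<omega>" "?s \<ge> 1" "wave_reaches cp t (Suc i) \<omega>"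
    "wave_reaches cp ?s (t + i + 1 - ?s) \<omega>"
    using assms by (auto simp: free_walks_def merges_def)
  have "X (t - 1) (Suc (Suc i)) = X (t - 1) (Suc i) + snd \<omega> (t - 1 + Suc i + 1 - ?s, ?s)"
    using * assms(1) by (intro spatial_queue_Suc_origin) (auto simp: leader_def)
  moreover have "X t (Suc i) = X t i + snd \<omega> (Suc i, t)"
    using * assms(1) by (cases t) (auto simp: spatial_queue_Suc_eq)
  ultimately show ?thesis
    using assms(1) by (simp add: gap_def free_increment_def)
qed

lemma free_increment_bound:
  assumes "t \<ge> 1" "free_walks cp t i \<omega>"
  shows "\<bar>free_increment cp t i \<omega>\<bar> \<le> cp"
proof -
  have "snd \<omega> (t + i + 1 - leader cp t i \<omega>, leader cp t i \<omega>) \<in> {cm..cp}"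
    using assms leader_less[of t cp i \<omega>] by (intro spacing_mem) (auto simp: free_walks_def)
  then show ?thesis
    using spacing_mem[of "i + 1" t] assms(1) cm_pos by (auto simp: free_increment_def)
qed

lemma leader_pos:
  assumes "t \<ge> 1" "real t * cm > real (i + 2) * cp"
  shows "leader cp t i \<omega> \<ge> 1"
proof -
  have "real (t - 1) * cm > real (Suc i) * cp"
    using assms cm_less_cp by (simp add: algebra_simps of_nat_diff)
  then show ?thesis unfolding leader_def by (intro origin_pos) auto
qed

text \<open>
  For a concave \<open>\<psi>\<close> the hypothesis \<open>taylor\<close> holds with \<open>h \<le> 0\<close>, so that \<open>\<psi>\<close> decreases on average; for
  a convex \<open>\<psi>\<close> with second derivative at most \<open>2\<close> it holds with \<open>h = 1\<close>, which limits the growth. In a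
  merge the true step replaces the free one in the first order term, which costs at most
  \<open>2 * cp * \<bar>g d\<bar>\<close>, and in the second order term, which costs at most \<open>2 * cp\<^sup>2\<close>.
\<close>
lemma gap_drift_le:
  fixes \<psi> g h :: "real \<Rightarrow> real"
  assumes t: "t \<ge> 1" "real t * cm > real (i + 2) * cp"
    and taylor: "\<And>d e. 0 \<le> d \<Longrightarrow> \<bar>e\<bar> \<le> cp \<Longrightarrow> \<psi> (d + e) \<le> \<psi> d + g d * e + h d * e\<^sup>2"
    and h: "\<And>d. \<bar>h d\<bar> \<le> 1"
  shows "\<psi> (D t (Suc i)) - \<psi> (D t i) \<le>
     of_bool (free_walks cp t i \<omega>) * (g (D t i) * free_increment cp t i \<omega>) +
     of_bool (free_walks cp t i \<omega>) * (h (D t i) * (free_increment cp t i \<omega>)\<^sup>2) +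
     of_bool (merges cp t i \<omega>) * (2 * cp * \<bar>g (D t i)\<bar> + 2 * cp\<^sup>2)"
proof -
  define d where "d = D t i"
  define e where "e = D t (Suc i) - D t i"
  define f where "f = free_increment cp t i \<omega>"
  have D: "D t i = d" "D t (Suc i) = d + e" by (simp_all add: d_def e_def)
  have d: "0 \<le> d" unfolding d_def using gap_nonneg t(1) by blast
  have e: "\<bar>e\<bar> \<le> cp" unfolding e_def by (rule gap_increment)
  show ?thesis
  proof (cases "free_walks cp t i \<omega>")
    case False
    then have "\<not> wave_reaches cp t i \<omega>"
      using leader_pos[OF t] by (simp add: free_walks_def)
    moreover from this have "\<not> wave_reaches cp t (Suc i) \<omega>"
      using wave_reaches_antimono[of cp t "Suc i" \<omega> i] by auto
    ultimately have "D t i = 0" "D t (Suc i) = 0" using gap_eq_0 t(1) by auto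
    with False show ?thesis by (simp add: merges_def)
  next
    case True
    have f: "\<bar>f\<bar> \<le> cp" unfolding f_def by (rule free_increment_bound[OF t(1) True])
    have main: "\<psi> (d + e) - \<psi> d \<le> g d * e + h d * e\<^sup>2" using taylor[OF d e] by simp
    show ?thesis
    proof (cases "merges cp t i \<omega>")
      case False
      then have "e = f" using gap_Suc_eq[OF t(1) True] by (simp add: e_def f_def)
      with main True False show ?thesis by (simp add: D f_def)
    next
      case merge: True
      have "g d * (e - f) \<le> \<bar>g d\<bar> * \<bar>e - f\<bar>" by (metis abs_ge_self abs_mult)
      also have "\<dots> \<le> \<bar>g d\<bar> * (2 * cp)" using e f by (intro mult_left_mono) auto
      finally have 1: "g d * (e - f) \<le> 2 * cp * \<bar>g d\<bar>" by (simp add: mult.commute)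
      have "\<bar>h d * x\<^sup>2\<bar> \<le> cp\<^sup>2" if "\<bar>x\<bar> \<le> cp" for x
        using mult_mono[OF h[of d] power_mono[OF that, of 2]] by (simp add: abs_mult)
      from this[OF e] this[OF f] have 2: "h d * e\<^sup>2 \<le> h d * f\<^sup>2 + 2 * cp\<^sup>2" by linarith
      show ?thesis using main 1 2 True merge by (simp add: D f_def algebra_simps)
    qed
  qed
qed

end

section \<open>The two test functions\<close>

text \<open>
  By convexity of \<open>(max (L - d) 0)\<^sup>2\<close> the tangent bounds it below; when the step cannot cross \<open>L\<close>, the
  function is a polynomial and the second order term is exact. That term yields the negative drift.
\<close>

lemma square_truncation_taylor:
  fixes L d e b :: real
  assumes "\<bar>e\<bar> \<le> b"
  shows "- (max (L - (d + e)) 0)\<^sup>2 \<le>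
           - (max (L - d) 0)\<^sup>2 + 2 * max (L - d) 0 * e + - of_bool (d \<le> L - b) * e\<^sup>2"
proof (cases "d \<le> L - b")
  case True
  then have "max (L - (d + e)) 0 = L - d - e" "max (L - d) 0 = L - d"
    using assms by (auto simp: max_def)
  with True show ?thesis by (simp add: power2_eq_square algebra_simps)
next
  case False
  have "(max (L - d) 0)\<^sup>2 - 2 * max (L - d) 0 * e \<le> (max (L - (d + e)) 0)\<^sup>2"
  proof (cases "d \<le> L")
    case True
    then have max_d: "max (L - d) 0 = L - d" by simp
    show ?thesis
    proof (cases "d + e \<le> L")
      case True
      then have "(max (L - (d + e)) 0)\<^sup>2 = (L - d)\<^sup>2 - 2 * (L - d) * e + e\<^sup>2"
        by (simp add: power2_eq_square algebra_simps)
      then show ?thesis unfolding max_d by simp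
    next
      case False
      then have "(L - d) * (L - d - 2 * e) \<le> 0"
        using \<open>d \<le> L\<close> by (intro mult_nonneg_nonpos) auto
      moreover have "(L - d)\<^sup>2 - 2 * (L - d) * e = (L - d) * (L - d - 2 * e)"
        by (simp add: power2_eq_square algebra_simps)
      ultimately show ?thesis
        using zero_le_power2[of "max (L - (d + e)) 0"] unfolding max_d by linarith
    qed
  qed simp
  with False show ?thesis by simp
qed

text \<open>
  The Huber function: \<open>d\<^sup>2\<close> for \<open>d \<le> L\<close>, continued by the tangent \<open>2 * L * d - L\<^sup>2\<close>. On
  nonnegative gaps its slope is at most \<open>2 * L\<close>, so that a merge at a large gap costs no more than order \<open>L\<close>.
\<close>

definition huber :: "real \<Rightarrow> real \<Rightarrow> real" where
  "huber L d = d\<^sup>2 - (max (d - L) 0)\<^sup>2"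

lemma huber_taylor: "huber L (d + e) \<le> huber L d + 2 * min d L * e + 1 * e\<^sup>2"
proof -
  have taylor: "- (max (- L - (- d + - e)) 0)\<^sup>2 \<le> - (max (- L - - d) 0)\<^sup>2 + 2 * max (- L - - d) 0 * - e
      + - of_bool (- d \<le> - L - \<bar>e\<bar>) * (- e)\<^sup>2"
    by (rule square_truncation_taylor) simp
  have shift: "- L - (- d + - e) = d + e - L" "- L - - d = d - L" by auto
  have "- of_bool (- d \<le> - L - \<bar>e\<bar>) * (- e)\<^sup>2 \<le> 0" by simp
  with taylor have "- (max (d + e - L) 0)\<^sup>2 \<le> - (max (d - L) 0)\<^sup>2 - 2 * max (d - L) 0 * e"
    unfolding shift by linarith
  moreover have "2 * min d L * e = 2 * d * e - 2 * max (d - L) 0 * e"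
    by (auto simp: min_def max_def algebra_simps)
  moreover have "(d + e)\<^sup>2 = d\<^sup>2 + 2 * d * e + e\<^sup>2" by (simp add: power2_eq_square algebra_simps)
  ultimately show ?thesis unfolding huber_def by linarith
qed

lemma huber_bounds:
  assumes "0 \<le> d" "0 \<le> L"
  shows "0 \<le> huber L d" "huber L d \<le> d\<^sup>2" "huber L d \<le> 2 * L * d" "d > L \<Longrightarrow> L * d \<le> huber L d"
proof -
  show "huber L d \<le> d\<^sup>2" by (simp add: huber_def)
  have 1: "huber L d = d * d" if "d \<le> L" using that by (simp add: huber_def power2_eq_square)
  have 2: "huber L d = 2 * L * d - L * L" if "d > L"
    using that by (simp add: huber_def power2_eq_square algebra_simps)
  have LL: "0 \<le> L * L" "0 \<le> L * d" using assms by auto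
  have 3: "L * d \<le> huber L d" if "d > L"
  proof -
    have "L * L \<le> L * d" using that assms by (intro mult_left_mono) auto
    then show ?thesis using 2[OF that] by linarith
  qed
  then show "d > L \<Longrightarrow> L * d \<le> huber L d" .
  show "0 \<le> huber L d"
  proof (cases "d \<le> L")
    case True
    then show ?thesis using 1 by simp
  next
    case False
    then show ?thesis using 3 LL by linarith
  qed
  show "huber L d \<le> 2 * L * d"
  proof (cases "d \<le> L")
    case True
    then have "d * d \<le> L * d" using assms by (intro mult_right_mono) auto
    then show ?thesis using 1[OF True] LL by linarith
  next
    case False
    then show ?thesis using 2 LL by linarith
  qed
qed

lemma abs_huber_le:
  assumes "0 \<le> d" "0 \<le> L"
  shows "\<bar>huber L d\<bar> \<le> 2 * L * (1 + d)"
proof -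
  have "2 * L * (1 + d) = 2 * L + 2 * L * d" by (simp add: algebra_simps)
  then show ?thesis using huber_bounds(1,3)[OF assms] assms(2) by linarith
qed

section \<open>The law of the process\<close>

text \<open>
  The walks up to column \<open>n\<close> are functions of the initial configuration and of the spacings in these
  columns. This is the filtration along which the gaps behave like martingales: it runs over columns, not over time.
\<close>

lemma queue_cong_columns:
  assumes fst: "fst \<omega> = fst \<omega>'"
    and snd: "\<And>a b. a \<ge> 1 \<Longrightarrow> b \<ge> 1 \<Longrightarrow> a + b \<le> n \<Longrightarrow> snd \<omega> (a, b) = snd \<omega>' (a, b)"
  shows "t + i \<le> n \<Longrightarrow> spatial_queue cp t \<omega> i = spatial_queue cp t \<omega>' i"
    and "t \<ge> 1 \<Longrightarrow> t + i \<le> n \<Longrightarrow> wave_reaches cp t i \<omega> = wave_reaches cp t i \<omega>'"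
    and "t + i \<le> n \<Longrightarrow> origin cp t i \<omega> = origin cp t i \<omega>'"
proof -
  have reach: "wave_reaches cp t i \<omega> = wave_reaches cp t i \<omega>'"
    if X: "\<And>i. t - 1 + i \<le> n \<Longrightarrow> spatial_queue cp (t - 1) \<omega> i = spatial_queue cp (t - 1) \<omega>' i"
      and "t \<ge> 1" "t + i \<le> n" for t i
    unfolding wave_reaches_def
  proof (rule ball_cong[OF refl])
    fix k assume k: "k \<in> {1..i}"
    have "(\<Sum>l=1..<k. snd \<omega> (l, t)) = (\<Sum>l=1..<k. snd \<omega>' (l, t))"
      using k that(2,3) by (intro sum.cong[OF refl] snd) auto
    then show "(\<Sum>l=1..<k. snd \<omega> (l, t)) < spatial_queue cp (t - 1) \<omega> (k + 1) - cp \<longleftrightarrow>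
          (\<Sum>l=1..<k. snd \<omega>' (l, t)) < spatial_queue cp (t - 1) \<omega>' (k + 1) - cp"
      using X[of "k + 1"] k that(2,3) by simp
  qed
  have X: "spatial_queue cp t \<omega> i = spatial_queue cp t \<omega>' i" if "t + i \<le> n" for t i
    using that
  proof (induction t arbitrary: i)
    case 0
    then show ?case using fst by simp
  next
    case (Suc t)
    have "(\<Sum>k=1..i. snd \<omega> (k, Suc t)) = (\<Sum>k=1..i. snd \<omega>' (k, Suc t))"
      using Suc.prems by (intro sum.cong[OF refl] snd) auto
    then show ?case
      using reach[of "Suc t" i] Suc by (simp add: spatial_queue_Suc_eq)
  qed
  show "t + i \<le> n \<Longrightarrow> spatial_queue cp t \<omega> i = spatial_queue cp t \<omega>' i" by (rule X)
  have reach': "wave_reaches cp t i \<omega> = wave_reaches cp t i \<omega>'" if "t \<ge> 1" "t + i \<le> n" for t i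
    using that by (intro reach X)
  show "t \<ge> 1 \<Longrightarrow> t + i \<le> n \<Longrightarrow> wave_reaches cp t i \<omega> = wave_reaches cp t i \<omega>'" by (rule reach')
  show "t + i \<le> n \<Longrightarrow> origin cp t i \<omega> = origin cp t i \<omega>'"
  proof (induction t arbitrary: i)
    case (Suc t)
    then show ?case using reach'[of "Suc t" i] by simp
  qed simp
qed

text \<open>
  Independence of one coordinate from a function of the others, where not depending on coordinate
  \<open>p\<close> is expressed by invariance under updates at \<open>p\<close>. The function then factors through the
  restriction to the other coordinates, with \<open>0\<close> filled in at \<open>p\<close>.
\<close>
lemma integral_PiM_mult_component:
  fixes f :: "('i \<Rightarrow> real) \<Rightarrow> real" and h :: "real \<Rightarrow> real"
  assumes \<mu>: "prob_space \<mu>" "sets \<mu> = sets borel"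
    and p: "p \<in> I"
    and f: "integrable (\<Pi>\<^sub>M i\<in>I. \<mu>) f" and f_upd: "\<And>\<xi> a. f (\<xi>(p := a)) = f \<xi>"
    and h: "integrable \<mu> h"
  shows "(\<integral>\<xi>. f \<xi> * h (\<xi> p) \<partial>(\<Pi>\<^sub>M i\<in>I. \<mu>)) = (\<integral>\<xi>. f \<xi> \<partial>(\<Pi>\<^sub>M i\<in>I. \<mu>)) * (\<integral>x. h x \<partial>\<mu>)"
proof -
  let ?N = "\<Pi>\<^sub>M i\<in>I. \<mu>"
  interpret \<mu>: prob_space \<mu> by fact
  interpret N: prob_space ?N by (intro prob_space_PiM \<mu>)
  have [measurable]: "f \<in> borel_measurable ?N" "h \<in> borel_measurable \<mu>"
    using f h by auto
  have comp: "distr ?N \<mu> (\<lambda>\<xi>. \<xi> i) = \<mu>" if "i \<in> I" for i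
    using that \<mu> by (intro distr_PiM_component)
  have "distr ?N ?N (\<lambda>\<xi>. \<lambda>i\<in>I. \<xi> i) = distr ?N ?N (\<lambda>\<xi>. \<xi>)"
    by (intro distr_cong refl) (auto simp: space_PiM PiE_def extensional_restrict)
  also have "\<dots> = (\<Pi>\<^sub>M i\<in>I. distr ?N \<mu> (\<lambda>\<xi>. \<xi> i))"
    by (simp add: distr_id2 comp cong: PiM_cong)
  finally have "N.indep_vars (\<lambda>_. \<mu>) (\<lambda>i \<xi>. \<xi> i) I"
    using p by (subst N.indep_vars_iff_distr_eq_PiM') auto
  then have indep: "N.indep_var (\<Pi>\<^sub>M i\<in>I - {p}. \<mu>) (\<lambda>\<xi>. restrict \<xi> (I - {p})) (\<Pi>\<^sub>M i\<in>{p}. \<mu>) (\<lambda>\<xi>. restrict \<xi> {p})"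
    using p N.indep_var_restrict[of "\<lambda>_. \<mu>" "\<lambda>i \<xi>. \<xi> i" I "I - {p}" "{p}"] by auto
  have space_\<mu>: "space \<mu> = UNIV" using sets_eq_imp_space_eq[OF \<mu>(2)] by simp
  have upd: "(\<lambda>\<eta>. \<eta>(p := 0)) \<in> measurable (\<Pi>\<^sub>M i\<in>I - {p}. \<mu>) ?N"
  proof -
    have "(\<lambda>\<eta>. (\<lambda>(f, y). f(p := y)) (\<eta>, 0)) \<in> measurable (\<Pi>\<^sub>M i\<in>I - {p}. \<mu>) (\<Pi>\<^sub>M i\<in>insert p (I - {p}). \<mu>)"
      by (rule measurable_compose[OF _ measurable_add_dim]) (auto simp: space_\<mu>)
    then show ?thesis using p by (simp add: insert_absorb)
  qed
  have "N.indep_var borel ((\<lambda>\<eta>. f (\<eta>(p := 0))) \<circ> (\<lambda>\<xi>. restrict \<xi> (I - {p})))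
      borel ((\<lambda>\<eta>. h (\<eta> p)) \<circ> (\<lambda>\<xi>. restrict \<xi> {p}))"
    by (rule N.indep_var_compose[OF indep]) (auto intro: measurable_compose[OF upd])
  then have ind: "N.indep_var borel (\<lambda>\<xi>. f ((restrict \<xi> (I - {p}))(p := 0))) borel (\<lambda>\<xi>. h (\<xi> p))"
    by (simp add: comp_def)
  have f_eq: "f ((restrict \<xi> (I - {p}))(p := 0)) = f \<xi>" if "\<xi> \<in> space ?N" for \<xi>
  proof -
    have "(restrict \<xi> (I - {p}))(p := 0) = \<xi>(p := 0)"
      using that by (auto simp: space_PiM PiE_def extensional_def fun_eq_iff)
    then show ?thesis by (simp add: f_upd)
  qed
  have int1: "integrable ?N (\<lambda>\<xi>. f ((restrict \<xi> (I - {p}))(p := 0)))"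
    using f by (subst Bochner_Integration.integrable_cong[OF refl f_eq]) auto
  have int2: "integrable ?N (\<lambda>\<xi>. h (\<xi> p))"
  proof -
    have "integrable (distr ?N \<mu> (\<lambda>\<xi>. \<xi> p)) h" using comp[OF p] h by simp
    then show ?thesis using p by (subst (asm) integrable_distr_eq) auto
  qed
  have "(\<integral>\<xi>. f \<xi> * h (\<xi> p) \<partial>?N) = (\<integral>\<xi>. f ((restrict \<xi> (I - {p}))(p := 0)) * h (\<xi> p) \<partial>?N)"
    using f_eq by (intro Bochner_Integration.integral_cong) auto
  also have "\<dots> = (\<integral>\<xi>. f ((restrict \<xi> (I - {p}))(p := 0)) \<partial>?N) * (\<integral>\<xi>. h (\<xi> p) \<partial>?N)"
    using int1 int2 by (intro N.indep_var_lebesgue_integral ind)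
  also have "(\<integral>\<xi>. f ((restrict \<xi> (I - {p}))(p := 0)) \<partial>?N) = (\<integral>\<xi>. f \<xi> \<partial>?N)"
    using f_eq by (intro Bochner_Integration.integral_cong) auto
  also have "(\<integral>\<xi>. h (\<xi> p) \<partial>?N) = (\<integral>x. h x \<partial>distr ?N \<mu> (\<lambda>\<xi>. \<xi> p))"
    using p by (subst integral_distr) auto
  also have "\<dots> = (\<integral>x. h x \<partial>\<mu>)" using comp[OF p] by simp
  finally show ?thesis .
qed

locale queue_model =
  fixes cm cp :: real and \<mu> :: "real measure" and \<nu> :: "(nat \<Rightarrow> real) measure"
  assumes cm_pos: "0 < cm" and cm_less_cp: "cm < cp"
    and prob_\<mu>: "prob_space \<mu>" and sets_\<mu>: "sets \<mu> = sets borel"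
    and support_\<mu>: "AE x in \<mu>. x \<in> {cm..cp}"
    and mean_\<mu>: "prob_space.expectation \<mu> (\<lambda>x. x) = 1"
    and initial: "initial_distribution cm cp \<nu>"
begin

abbreviation N where "N \<equiv> \<Pi>\<^sub>M p\<in>{1::nat..} \<times> {1::nat..}. \<mu>"
abbreviation P where "P \<equiv> queue_space \<mu> \<nu>"
abbreviation v where "v \<equiv> prob_space.variance \<mu> (\<lambda>x. x)"

lemma prob_\<nu>: "prob_space \<nu>"
  using initial by (simp add: initial_distribution_def)

lemma prob_N: "prob_space N"
  by (intro prob_space_PiM prob_\<mu>)

lemma prob_P: "prob_space P"
  unfolding queue_space_def by (intro prob_space_pair prob_\<nu> prob_N)

lemma pair_\<nu>_N: "pair_sigma_finite \<nu> N"
  by (intro pair_sigma_finite.intro prob_space_imp_sigma_finite prob_\<nu> prob_N)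

lemma cp_pos: "0 < cp"
  using cm_pos cm_less_cp by simp

lemma sets_\<nu>: "sets \<nu> = sets (\<Pi>\<^sub>M i\<in>UNIV. (borel :: real measure))"
  using initial by (simp add: initial_distribution_def)

lemma measurable_initial [measurable]: "(\<lambda>\<omega>. fst \<omega> i) \<in> borel_measurable P"
proof -
  have "(\<lambda>x. x i) \<in> borel_measurable \<nu>"
    unfolding measurable_cong_sets[OF sets_\<nu> refl] by (rule measurable_component_singleton) simp
  then show ?thesis
    unfolding queue_space_def by (rule measurable_compose[OF measurable_fst])
qed

lemma measurable_spacing [measurable]:
  assumes "i \<ge> 1" "t \<ge> 1"
  shows "(\<lambda>\<omega>. snd \<omega> (i, t)) \<in> borel_measurable P"
proof -
  have "(\<lambda>\<xi>. \<xi> (i, t)) \<in> measurable N \<mu>"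
    using assms by (intro measurable_component_singleton[of "(i, t)" "{1..} \<times> {1..}" "\<lambda>_. \<mu>"]) simp
  then have "(\<lambda>\<omega>. snd \<omega> (i, t)) \<in> measurable P \<mu>"
    unfolding queue_space_def by (rule measurable_compose[OF measurable_snd])
  then show ?thesis
    unfolding measurable_cong_sets[OF refl sets_\<mu>] .
qed

lemma measurable_queue:
  "(\<lambda>\<omega>. spatial_queue cp t \<omega> i) \<in> borel_measurable P"
  "t \<ge> 1 \<Longrightarrow> Measurable.pred P (wave_reaches cp t i)"
proof -
  have reach: "Measurable.pred P (wave_reaches cp t i)"
    if [measurable]: "\<And>i. (\<lambda>\<omega>. spatial_queue cp (t - 1) \<omega> i) \<in> borel_measurable P" and "t \<ge> 1" for t i
  proof -
    have [measurable]: "(\<lambda>\<omega>. \<Sum>l=1..<k. snd \<omega> (l, t)) \<in> borel_measurable P" for k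
      using that(2) by (intro borel_measurable_sum measurable_spacing) auto
    show ?thesis unfolding wave_reaches_def by measurable
  qed
  have X: "(\<lambda>\<omega>. spatial_queue cp t \<omega> i) \<in> borel_measurable P" for t i
  proof (induction t arbitrary: i)
    case 0
    then show ?case by simp
  next
    case (Suc t)
    note Suc.IH[measurable]
    have [measurable]: "Measurable.pred P (wave_reaches cp (Suc t) i)"
      using Suc.IH by (intro reach) auto
    have [measurable]: "(\<lambda>\<omega>. \<Sum>k=1..i. snd \<omega> (k, Suc t)) \<in> borel_measurable P"
      by (intro borel_measurable_sum measurable_spacing) auto
    show ?case unfolding spatial_queue_Suc_eq by measurable
  qed
  show "(\<lambda>\<omega>. spatial_queue cp t \<omega> i) \<in> borel_measurable P" by (rule X)
  show "t \<ge> 1 \<Longrightarrow> Measurable.pred P (wave_reaches cp t i)" by (intro reach X)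
qed

lemma measurable_gap [measurable]: "gap cp t i \<in> borel_measurable P"
  unfolding gap_def[abs_def] using measurable_queue(1)[measurable] by measurable

lemma measurable_origin [measurable]: "origin cp t i \<in> measurable P (count_space UNIV)"
proof (induction t arbitrary: i)
  case (Suc t)
  note Suc[measurable] measurable_queue(2)[of "Suc t" i, simplified, measurable]
  show ?case by (simp add: origin.simps(2)[abs_def])
next
  case 0
  then show ?case by (simp add: origin.simps(1)[abs_def])
qed

lemma measurable_leader [measurable]: "leader cp t i \<in> measurable P (count_space UNIV)"
  unfolding leader_def[abs_def] by measurable

lemma measurable_free_walks: "t \<ge> 1 \<Longrightarrow> Measurable.pred P (free_walks cp t i)"
  unfolding free_walks_def[abs_def] using measurable_queue(2)[measurable] by measurable

text \<open>
  The leader is a random index; splitting over its finitely many values reduces measurability to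
  fixed walks.
\<close>

lemma measurable_merges:
  assumes t: "t \<ge> 1"
  shows "Measurable.pred P (merges cp t i)"
proof -
  note measurable_free_walks[OF t, measurable] measurable_queue(2)[OF t, measurable]
  have [measurable]: "Measurable.pred P (wave_reaches cp s k)" if "s \<in> {1..<t}" for s k
    using that by (intro measurable_queue) auto
  have eq: "merges cp t i \<omega> \<longleftrightarrow> free_walks cp t i \<omega> \<and>
     (\<not> wave_reaches cp t (i + 1) \<omega> \<or>
      (\<exists>s\<in>{1..<t}. leader cp t i \<omega> = s \<and> \<not> wave_reaches cp s (t + i + 1 - s) \<omega>))" for \<omega>
    using leader_less[OF t, of cp i \<omega>] by (auto simp: merges_def free_walks_def)
  show ?thesis unfolding eq[abs_def] by measurable
qed

lemma AE_spacing:
  assumes "i \<ge> 1" "t \<ge> 1"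
  shows "AE \<omega> in P. snd \<omega> (i, t) \<in> {cm..cp}"
proof -
  note measurable_spacing[OF assms, measurable]
  have "AE \<xi> in N. \<xi> (i, t) \<in> {cm..cp}"
    using assms support_\<mu> prob_\<mu> by (intro AE_PiM_component) auto
  moreover have "{\<omega> \<in> space P. snd \<omega> (i, t) \<in> {cm..cp}} \<in> sets P" by measurable
  ultimately show ?thesis
    unfolding queue_space_def by (intro pair_sigma_finite.AE_pair_measure[OF pair_\<nu>_N]) auto
qed

lemma AE_queue_path: "AE \<omega> in P. queue_path cm cp \<omega>"
proof -
  have "distr P \<nu> fst = \<nu>"
    unfolding queue_space_def by (rule prob_space.distr_pair_fst[OF prob_N])
  then have "AE x in distr P \<nu> fst. x \<in> configurations cm cp"
    using initial by (simp only: initial_distribution_def)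
  then have "AE \<omega> in P. fst \<omega> \<in> configurations cm cp"
    by (rule AE_distrD[rotated]) (simp add: queue_space_def)
  moreover have "AE \<omega> in P. \<forall>i t. i \<ge> 1 \<longrightarrow> t \<ge> 1 \<longrightarrow> snd \<omega> (i, t) \<in> {cm..cp}"
    using AE_spacing by (auto simp: AE_all_countable AE_impI)
  ultimately show ?thesis
    by eventually_elim (unfold_locales, use cm_pos cm_less_cp in auto)
qed

lemma integrable_bounded:
  assumes "f \<in> borel_measurable P" "\<And>\<omega>. queue_path cm cp \<omega> \<Longrightarrow> \<bar>f \<omega>\<bar> \<le> B"
  shows "integrable P (f :: _ \<Rightarrow> real)"
proof (rule finite_measure.integrable_const_bound[OF prob_space.finite_measure[OF prob_P], of _ B])
  show "AE \<omega> in P. norm (f \<omega>) \<le> B"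
    using AE_queue_path by eventually_elim (use assms in auto)
qed fact

text \<open>
  Fubini's theorem reduces to a fixed initial configuration. Bounds on good outcomes suffice for
  integrability, as almost every outcome is good.
\<close>

lemma integral_mult_spacing:
  assumes f: "f \<in> borel_measurable P" "\<And>\<omega>. queue_path cm cp \<omega> \<Longrightarrow> \<bar>f \<omega>\<bar> \<le> B"
    and f_upd: "\<And>x \<xi> a. f (x, \<xi>(p := a)) = (f (x, \<xi>) :: real)"
    and p: "p \<in> {1..} \<times> {1..}"
    and h: "h \<in> borel_measurable borel" "\<And>x. x \<in> {cm..cp} \<Longrightarrow> \<bar>h x\<bar> \<le> C"
  shows "(\<integral>\<omega>. f \<omega> * h (snd \<omega> p) \<partial>P) = (\<integral>\<omega>. f \<omega> \<partial>P) * (\<integral>x. h x \<partial>\<mu>)"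
proof -
  note h(1)[measurable]
  have [measurable]: "(\<lambda>\<omega>. snd \<omega> p) \<in> borel_measurable P"
    using p measurable_spacing[of "fst p" "snd p"] by auto
  have int_f: "integrable P f" by (rule integrable_bounded[OF f])
  have "integrable P (\<lambda>\<omega>. f \<omega> * h (snd \<omega> p))"
  proof (rule integrable_bounded)
    fix \<omega> assume "queue_path cm cp \<omega>"
    then interpret queue_path cm cp \<omega> .
    have "\<bar>h (snd \<omega> p)\<bar> \<le> C"
      using p spacing_mem[of "fst p" "snd p"] by (intro h(2)) auto
    then show "\<bar>f \<omega> * h (snd \<omega> p)\<bar> \<le> B * C"
      using f(2)[of \<omega>] queue_path_axioms unfolding abs_mult by (intro mult_mono) auto
  qed (use f in measurable)
  then have "(\<integral>\<omega>. f \<omega> * h (snd \<omega> p) \<partial>P) = (\<integral>x. (\<integral>\<xi>. f (x, \<xi>) * h (\<xi> p) \<partial>N) \<partial>\<nu>)"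
    unfolding queue_space_def by (subst pair_sigma_finite.integral_fst'[OF pair_\<nu>_N, symmetric]) auto
  also have "\<dots> = (\<integral>x. (\<integral>\<xi>. f (x, \<xi>) \<partial>N) * (\<integral>x. h x \<partial>\<mu>) \<partial>\<nu>)"
  proof (rule integral_cong_AE)
    have [measurable]: "f \<in> borel_measurable (\<nu> \<Otimes>\<^sub>M N)" "(\<lambda>\<omega>. snd \<omega> p) \<in> borel_measurable (\<nu> \<Otimes>\<^sub>M N)"
      using f(1) \<open>(\<lambda>\<omega>. snd \<omega> p) \<in> borel_measurable P\<close> unfolding queue_space_def by auto
    have "(\<lambda>x. \<integral>\<xi>. (\<lambda>\<omega>. f \<omega> * h (snd \<omega> p)) (x, \<xi>) \<partial>N) \<in> borel_measurable \<nu>"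
      by (rule sigma_finite_measure.borel_measurable_lebesgue_integral[OF prob_space_imp_sigma_finite[OF prob_N]]) measurable
    then show "(\<lambda>x. \<integral>\<xi>. f (x, \<xi>) * h (\<xi> p) \<partial>N) \<in> borel_measurable \<nu>" by simp
    have "(\<lambda>x. \<integral>\<xi>. f (x, \<xi>) \<partial>N) \<in> borel_measurable \<nu>"
      by (rule sigma_finite_measure.borel_measurable_lebesgue_integral[OF prob_space_imp_sigma_finite[OF prob_N]]) measurable
    then show "(\<lambda>x. (\<integral>\<xi>. f (x, \<xi>) \<partial>N) * (\<integral>x. h x \<partial>\<mu>)) \<in> borel_measurable \<nu>"
      by (intro borel_measurable_times borel_measurable_const)
    have "integrable \<mu> h"
    proof (rule finite_measure.integrable_const_bound[OF prob_space.finite_measure[OF prob_\<mu>], of _ C])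
      show "AE x in \<mu>. norm (h x) \<le> C" using support_\<mu> by eventually_elim (use h in auto)
      show "h \<in> borel_measurable \<mu>"
        unfolding measurable_cong_sets[OF sets_\<mu> refl] by fact
    qed
    moreover have "AE x in \<nu>. integrable N (\<lambda>\<xi>. f (x, \<xi>))"
      using int_f unfolding queue_space_def by (rule pair_sigma_finite.AE_integrable_fst'[OF pair_\<nu>_N])
    ultimately show "AE x in \<nu>. (\<integral>\<xi>. f (x, \<xi>) * h (\<xi> p) \<partial>N) = (\<integral>\<xi>. f (x, \<xi>) \<partial>N) * (\<integral>x. h x \<partial>\<mu>)"
      using p f_upd by (auto intro!: integral_PiM_mult_component[OF prob_\<mu> sets_\<mu>] elim!: eventually_mono)
  qed
  also have "\<dots> = (\<integral>x. (\<integral>\<xi>. f (x, \<xi>) \<partial>N) \<partial>\<nu>) * (\<integral>x. h x \<partial>\<mu>)"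
    by (rule integral_mult_left_zero)
  also have "(\<integral>x. (\<integral>\<xi>. f (x, \<xi>) \<partial>N) \<partial>\<nu>) = (\<integral>\<omega>. f \<omega> \<partial>P)"
    using int_f unfolding queue_space_def by (rule pair_sigma_finite.integral_fst'[OF pair_\<nu>_N])
  finally show ?thesis .
qed

end

section \<open>Expected drift of functions of the gap\<close>

context queue_model begin

abbreviation E :: "((nat \<Rightarrow> real) \<times> (nat \<times> nat \<Rightarrow> real) \<Rightarrow> real) \<Rightarrow> real" where
  "E f \<equiv> (\<integral>\<omega>. f \<omega> \<partial>P)"

lemma variance_eq: "v = (\<integral>x. x\<^sup>2 \<partial>\<mu>) - 1"
proof -
  interpret \<mu>: prob_space \<mu> by (fact prob_\<mu>)
  have "integrable \<mu> (\<lambda>x. x ^ n)" for n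
  proof (rule \<mu>.integrable_const_bound[of _ "cp ^ n"])
    show "AE x in \<mu>. norm (x ^ n) \<le> cp ^ n"
      using support_\<mu> by eventually_elim (use cm_pos in \<open>auto intro!: power_mono simp: norm_power\<close>)
    show "(\<lambda>x. x ^ n) \<in> borel_measurable \<mu>"
      unfolding measurable_cong_sets[OF sets_\<mu> refl] by measurable
  qed
  from this[of 1] this[of 2] show ?thesis
    using mean_\<mu> by (subst \<mu>.variance_eq) auto
qed

text \<open>
  Multiply out: each spacing has mean \<open>1\<close> and is independent of \<open>G\<close>, and for the cross term
  \<open>G * \<xi>\<^sub>q\<close> is in turn a function that does not depend on the coordinate \<open>p\<close>.
\<close>

lemma moments_difference:
  fixes G :: "_ \<Rightarrow> real"
  assumes G: "G \<in> borel_measurable P" "\<And>\<omega>. queue_path cm cp \<omega> \<Longrightarrow> \<bar>G \<omega>\<bar> \<le> B"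
    and p: "p \<in> {1..} \<times> {1..}" and q: "q \<in> {1..} \<times> {1..}" and "p \<noteq> q"
    and G_p: "\<And>x \<xi> a. G (x, \<xi>(p := a)) = G (x, \<xi>)"
    and G_q: "\<And>x \<xi> a. G (x, \<xi>(q := a)) = G (x, \<xi>)"
  shows "E (\<lambda>\<omega>. G \<omega> * (snd \<omega> p - snd \<omega> q)) = 0"
    and "E (\<lambda>\<omega>. G \<omega> * (snd \<omega> p - snd \<omega> q)\<^sup>2) = 2 * v * E G"
    and "integrable P (\<lambda>\<omega>. G \<omega> * (snd \<omega> p - snd \<omega> q))"
    and "integrable P (\<lambda>\<omega>. G \<omega> * (snd \<omega> p - snd \<omega> q)\<^sup>2)"
proof -
  have meas: "(\<lambda>\<omega>. snd \<omega> p) \<in> borel_measurable P" "(\<lambda>\<omega>. snd \<omega> q) \<in> borel_measurable P"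
    using p q measurable_spacing[of "fst p" "snd p"] measurable_spacing[of "fst q" "snd q"] by auto
  note meas[measurable] G(1)[measurable]
  have bound: "\<bar>snd \<omega> p\<bar> \<le> cp" "\<bar>snd \<omega> q\<bar> \<le> cp" if "queue_path cm cp \<omega>" for \<omega>
    using queue_path.spacing_mem[OF that, of "fst p" "snd p"]
      queue_path.spacing_mem[OF that, of "fst q" "snd q"] p q cm_pos by auto
  have int: "integrable P (\<lambda>\<omega>. G \<omega> * (snd \<omega> p ^ a * snd \<omega> q ^ b))" for a b
  proof (rule integrable_bounded)
    fix \<omega> assume path: "queue_path cm cp \<omega>"
    show "\<bar>G \<omega> * (snd \<omega> p ^ a * snd \<omega> q ^ b)\<bar> \<le> B * (cp ^ a * cp ^ b)"
      using bound[OF path] G(2)[OF path] cp_pos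
      unfolding abs_mult power_abs by (intro mult_mono power_mono) auto
  qed measurable
  have Gpow: "E (\<lambda>\<omega>. G \<omega> * snd \<omega> r ^ k) = E G * (\<integral>x. x ^ k \<partial>\<mu>)" if "r = p \<or> r = q" for r k
    using that p q G_p G_q cm_pos
    by (intro integral_mult_spacing[OF G, where C = "cp ^ k"])
       (auto simp: power_abs intro!: power_mono)
  have cross: "E (\<lambda>\<omega>. (G \<omega> * snd \<omega> q) * snd \<omega> p) = E (\<lambda>\<omega>. G \<omega> * snd \<omega> q) * (\<integral>x. x \<partial>\<mu>)"
  proof (rule integral_mult_spacing[where B = "B * cp" and C = cp])
    fix \<omega> assume path: "queue_path cm cp \<omega>"
    show "\<bar>G \<omega> * snd \<omega> q\<bar> \<le> B * cp"
      using bound[OF path] G(2)[OF path] cp_pos unfolding abs_mult by (intro mult_mono) auto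
  qed (use p \<open>p \<noteq> q\<close> G_p cm_pos in auto)
  have 1: "E (\<lambda>\<omega>. G \<omega> * snd \<omega> p) = E G" "E (\<lambda>\<omega>. G \<omega> * snd \<omega> q) = E G"
    using Gpow[of p 1] Gpow[of q 1] mean_\<mu> by auto
  have I: "integrable P (\<lambda>\<omega>. G \<omega> * snd \<omega> p)" "integrable P (\<lambda>\<omega>. G \<omega> * snd \<omega> q)"
    "integrable P (\<lambda>\<omega>. G \<omega> * (snd \<omega> p)\<^sup>2)" "integrable P (\<lambda>\<omega>. G \<omega> * (snd \<omega> q)\<^sup>2)"
    "integrable P (\<lambda>\<omega>. G \<omega> * snd \<omega> q * snd \<omega> p)"
    using int[of 1 0] int[of 0 1] int[of 2 0] int[of 0 2] int[of 1 1] by (auto simp: mult_ac)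
  have lin: "(\<lambda>\<omega>. G \<omega> * (snd \<omega> p - snd \<omega> q)) = (\<lambda>\<omega>. G \<omega> * snd \<omega> p - G \<omega> * snd \<omega> q)"
    by (simp add: algebra_simps)
  have quad: "(\<lambda>\<omega>. G \<omega> * (snd \<omega> p - snd \<omega> q)\<^sup>2) =
      (\<lambda>\<omega>. G \<omega> * (snd \<omega> p)\<^sup>2 + G \<omega> * (snd \<omega> q)\<^sup>2 - 2 * (G \<omega> * snd \<omega> q * snd \<omega> p))"
    by (simp add: fun_eq_iff power2_eq_square algebra_simps)
  show "E (\<lambda>\<omega>. G \<omega> * (snd \<omega> p - snd \<omega> q)) = 0"
    "integrable P (\<lambda>\<omega>. G \<omega> * (snd \<omega> p - snd \<omega> q))"
    unfolding lin using I 1 by auto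
  show "integrable P (\<lambda>\<omega>. G \<omega> * (snd \<omega> p - snd \<omega> q)\<^sup>2)"
    unfolding quad using I by (intro Bochner_Integration.integrable_diff Bochner_Integration.integrable_add integrable_mult_right)
  have "E (\<lambda>\<omega>. G \<omega> * (snd \<omega> p - snd \<omega> q)\<^sup>2) =
      E (\<lambda>\<omega>. G \<omega> * (snd \<omega> p)\<^sup>2) + E (\<lambda>\<omega>. G \<omega> * (snd \<omega> q)\<^sup>2) - 2 * E (\<lambda>\<omega>. G \<omega> * snd \<omega> q * snd \<omega> p)"
    unfolding quad using I by simp
  also have "\<dots> = E G * (v + 1) + E G * (v + 1) - 2 * E G"
  proof -
    have "(\<integral>x. x\<^sup>2 \<partial>\<mu>) = v + 1" using variance_eq by linarith
    moreover have "E (\<lambda>\<omega>. G \<omega> * snd \<omega> q * snd \<omega> p) = E G" using cross 1 mean_\<mu> by simp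
    ultimately show ?thesis using Gpow[of p 2] Gpow[of q 2] by (simp only: simp_thms)
  qed
  also have "\<dots> = 2 * v * E G"
  proof -
    have "a * (w + 1) + a * (w + 1) - 2 * a = 2 * w * a" for a w :: real
      by (simp add: algebra_simps)
    then show ?thesis .
  qed
  finally show "E (\<lambda>\<omega>. G \<omega> * (snd \<omega> p - snd \<omega> q)\<^sup>2) = 2 * v * E G" .
qed

text \<open>
  The position of the leader's spacing is random, so the expectation is split over the leaders \<open>s\<close>.
  On each part the spacings sit at fixed coordinates of column \<open>t + i + 1\<close>, which neither the gap nor
  the event depends on.
\<close>

lemma free_increment_moments:
  assumes t: "t \<ge> 1" and g: "g \<in> borel_measurable borel" "\<And>d. 0 \<le> d \<Longrightarrow> \<bar>g d\<bar> \<le> B"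
  shows "E (\<lambda>\<omega>. of_bool (free_walks cp t i \<omega>) * (g (gap cp t i \<omega>) * free_increment cp t i \<omega>)) = 0"
    and "E (\<lambda>\<omega>. of_bool (free_walks cp t i \<omega>) * (g (gap cp t i \<omega>) * (free_increment cp t i \<omega>)\<^sup>2))
           = 2 * v * E (\<lambda>\<omega>. of_bool (free_walks cp t i \<omega>) * g (gap cp t i \<omega>))"
    and "integrable P (\<lambda>\<omega>. of_bool (free_walks cp t i \<omega>) * (g (gap cp t i \<omega>) * free_increment cp t i \<omega>))"
    and "integrable P (\<lambda>\<omega>. of_bool (free_walks cp t i \<omega>) * (g (gap cp t i \<omega>) * (free_increment cp t i \<omega>)\<^sup>2))"
    and "integrable P (\<lambda>\<omega>. of_bool (free_walks cp t i \<omega>) * g (gap cp t i \<omega>))"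
proof -
  define G where "G s \<omega> = of_bool (wave_reaches cp t i \<omega> \<and> leader cp t i \<omega> = s) * g (gap cp t i \<omega>)"
    for s \<omega>
  let ?q = "(i + 1, t)" and ?p = "\<lambda>s. (t + i + 1 - s, s)"
  have upd: "G s (x, \<xi>(r := a)) = G s (x, \<xi>)" if "fst r + snd r = t + i + 1" for s x \<xi> r a
  proof -
    have "snd (x, \<xi>(r := a)) (k, l) = snd (x, \<xi>) (k, l)" if "k + l \<le> t + i" for k l
      using that \<open>fst r + snd r = t + i + 1\<close> by auto
    note cong = queue_cong_columns[of "(x, \<xi>(r := a))" "(x, \<xi>)" "t + i", OF _ this, simplified]
    have "spatial_queue cp t (x, \<xi>(r := a)) i = spatial_queue cp t (x, \<xi>) i"
      "spatial_queue cp (t - 1) (x, \<xi>(r := a)) (Suc i) = spatial_queue cp (t - 1) (x, \<xi>) (Suc i)"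
      "wave_reaches cp t i (x, \<xi>(r := a)) = wave_reaches cp t i (x, \<xi>)"
      "origin cp (t - 1) (Suc i) (x, \<xi>(r := a)) = origin cp (t - 1) (Suc i) (x, \<xi>)"
      using t by (auto intro!: cong)
    then show ?thesis by (simp add: G_def gap_def leader_def)
  qed
  note [measurable] = g(1) measurable_queue(2)[OF t]
  have G_meas: "G s \<in> borel_measurable P" for s unfolding G_def[abs_def] by measurable
  have G_bound: "\<bar>G s \<omega>\<bar> \<le> B" if "queue_path cm cp \<omega>" for s \<omega>
    using g(2)[OF queue_path.gap_nonneg[OF that t, of i]] by (auto simp: G_def abs_mult)
  have int_G: "integrable P (G s)" for s by (rule integrable_bounded[OF G_meas G_bound])
  have mom: "E (\<lambda>\<omega>. G s \<omega> * (snd \<omega> (?p s) - snd \<omega> ?q)) = 0"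
    "E (\<lambda>\<omega>. G s \<omega> * (snd \<omega> (?p s) - snd \<omega> ?q)\<^sup>2) = 2 * v * E (G s)"
    "integrable P (\<lambda>\<omega>. G s \<omega> * (snd \<omega> (?p s) - snd \<omega> ?q))"
    "integrable P (\<lambda>\<omega>. G s \<omega> * (snd \<omega> (?p s) - snd \<omega> ?q)\<^sup>2)" if "s \<in> {1..<t}" for s
    by (rule moments_difference[OF G_meas G_bound]; use that in \<open>auto intro!: upd\<close>)+
  have split: "of_bool (free_walks cp t i \<omega>) * (g (gap cp t i \<omega>) * F (leader cp t i \<omega>)) =
      (\<Sum>s\<in>{1..<t}. G s \<omega> * F s)" for \<omega> F
  proof -
    have "(\<Sum>s\<in>{1..<t}. G s \<omega> * F s) = (\<Sum>s\<in>{1..<t}. if s = leader cp t i \<omega>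
        then of_bool (wave_reaches cp t i \<omega>) * (g (gap cp t i \<omega>) * F s) else 0)"
      by (intro sum.cong) (auto simp: G_def)
    then show ?thesis
      using leader_less[OF t, of cp i \<omega>] by (auto simp: free_walks_def)
  qed
  have eq1: "of_bool (free_walks cp t i \<omega>) * (g (gap cp t i \<omega>) * free_increment cp t i \<omega>) =
      (\<Sum>s\<in>{1..<t}. G s \<omega> * (snd \<omega> (?p s) - snd \<omega> ?q))" for \<omega>
    using split[of \<omega> "\<lambda>s. snd \<omega> (?p s) - snd \<omega> ?q"] by (simp add: free_increment_def)
  have eq2: "of_bool (free_walks cp t i \<omega>) * (g (gap cp t i \<omega>) * (free_increment cp t i \<omega>)\<^sup>2) =
      (\<Sum>s\<in>{1..<t}. G s \<omega> * (snd \<omega> (?p s) - snd \<omega> ?q)\<^sup>2)" for \<omega>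
    using split[of \<omega> "\<lambda>s. (snd \<omega> (?p s) - snd \<omega> ?q)\<^sup>2"] by (simp add: free_increment_def)
  have eq0: "of_bool (free_walks cp t i \<omega>) * g (gap cp t i \<omega>) = (\<Sum>s\<in>{1..<t}. G s \<omega>)" for \<omega>
    using split[of \<omega> "\<lambda>s. 1"] by simp
  show "E (\<lambda>\<omega>. of_bool (free_walks cp t i \<omega>) * (g (gap cp t i \<omega>) * free_increment cp t i \<omega>)) = 0"
    and "integrable P (\<lambda>\<omega>. of_bool (free_walks cp t i \<omega>) * (g (gap cp t i \<omega>) * free_increment cp t i \<omega>))"
    unfolding eq1 using mom by (auto simp: Bochner_Integration.integral_sum)
  show "integrable P (\<lambda>\<omega>. of_bool (free_walks cp t i \<omega>) * g (gap cp t i \<omega>))"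
    unfolding eq0 using int_G by auto
  show "integrable P (\<lambda>\<omega>. of_bool (free_walks cp t i \<omega>) * (g (gap cp t i \<omega>) * (free_increment cp t i \<omega>)\<^sup>2))"
    unfolding eq2 using mom by auto
  show "E (\<lambda>\<omega>. of_bool (free_walks cp t i \<omega>) * (g (gap cp t i \<omega>) * (free_increment cp t i \<omega>)\<^sup>2))
      = 2 * v * E (\<lambda>\<omega>. of_bool (free_walks cp t i \<omega>) * g (gap cp t i \<omega>))"
    unfolding eq0 eq2 using mom int_G by (simp add: Bochner_Integration.integral_sum sum_distrib_left)
qed

lemma integrable_gap: "t \<ge> 1 \<Longrightarrow> integrable P (gap cp t i)"
  using queue_path.gap_nonneg queue_path.gap_le
  by (intro integrable_bounded[where B = "real (Suc i) * cp"]) auto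

lemma integrable_of_gap:
  assumes t: "t \<ge> 1" and \<psi>: "\<psi> \<in> borel_measurable borel" "\<And>d. 0 \<le> d \<Longrightarrow> \<bar>\<psi> d\<bar> \<le> K * (1 + d)"
  shows "integrable P (\<lambda>\<omega>. \<psi> (gap cp t i \<omega>))"
proof (rule integrable_bounded)
  note \<psi>(1)[measurable]
  show "(\<lambda>\<omega>. \<psi> (gap cp t i \<omega>)) \<in> borel_measurable P" by measurable
  fix \<omega> assume path: "queue_path cm cp \<omega>"
  have "0 \<le> K" using \<psi>(2)[of 0] by simp
  then show "\<bar>\<psi> (gap cp t i \<omega>)\<bar> \<le> K * (1 + real (Suc i) * cp)"
    using queue_path.gap_nonneg[OF path t, of i] queue_path.gap_le[OF path t, of i]
    by (intro order_trans[OF \<psi>(2)] mult_left_mono) auto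
qed

lemma integrable_merges_mult:
  fixes f :: "_ \<Rightarrow> real"
  assumes t: "t \<ge> 1" and f: "f \<in> borel_measurable P" "\<And>\<omega>. queue_path cm cp \<omega> \<Longrightarrow> \<bar>f \<omega>\<bar> \<le> B"
  shows "integrable P (\<lambda>\<omega>. of_bool (merges cp t i \<omega>) * f \<omega>)"
proof (rule integrable_bounded)
  note measurable_merges[OF t, measurable] f(1)[measurable]
  show "(\<lambda>\<omega>. of_bool (merges cp t i \<omega>) * f \<omega>) \<in> borel_measurable P" by measurable
  fix \<omega> assume path: "queue_path cm cp \<omega>"
  show "\<bar>of_bool (merges cp t i \<omega>) * f \<omega>\<bar> \<le> B"
    using f(2)[OF path] by (auto simp: abs_mult)
qed

text \<open>
  The first order term of \<open>gap_drift_le\<close> vanishes in expectation and the second order term becomes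
  the variance \<open>2 * v\<close> of a free step.
\<close>

lemma expected_drift_le:
  fixes \<psi> g h :: "real \<Rightarrow> real"
  assumes t: "t \<ge> 1" "real t * cm > real (i + 2) * cp"
    and taylor: "\<And>d e. 0 \<le> d \<Longrightarrow> \<bar>e\<bar> \<le> cp \<Longrightarrow> \<psi> (d + e) \<le> \<psi> d + g d * e + h d * e\<^sup>2"
    and h: "\<And>d. \<bar>h d\<bar> \<le> 1" "h \<in> borel_measurable borel"
    and g: "\<And>d. 0 \<le> d \<Longrightarrow> \<bar>g d\<bar> \<le> B" "g \<in> borel_measurable borel"
    and \<psi>: "\<And>d. 0 \<le> d \<Longrightarrow> \<bar>\<psi> d\<bar> \<le> K * (1 + d)" "\<psi> \<in> borel_measurable borel"
  shows "E (\<lambda>\<omega>. \<psi> (gap cp t (Suc i) \<omega>)) - E (\<lambda>\<omega>. \<psi> (gap cp t i \<omega>)) \<le>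
           2 * v * E (\<lambda>\<omega>. of_bool (free_walks cp t i \<omega>) * h (gap cp t i \<omega>)) +
           E (\<lambda>\<omega>. of_bool (merges cp t i \<omega>) * (2 * cp * \<bar>g (gap cp t i \<omega>)\<bar> + 2 * cp\<^sup>2))"
proof -
  note g(2)[measurable]
  have int_\<psi>: "integrable P (\<lambda>\<omega>. \<psi> (gap cp t i \<omega>))" for i
    by (rule integrable_of_gap[OF t(1) \<psi>(2,1)])
  note mom_g = free_increment_moments[OF t(1) g(2) g(1), of i, simplified]
  note mom_h = free_increment_moments[OF t(1) h(2) h(1), of i, simplified]
  have int_m: "integrable P (\<lambda>\<omega>. of_bool (merges cp t i \<omega>) * (2 * cp * \<bar>g (gap cp t i \<omega>)\<bar> + 2 * cp\<^sup>2))"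
  proof (rule integrable_merges_mult[OF t(1)])
    fix \<omega> assume "queue_path cm cp \<omega>"
    then have "2 * cp * \<bar>g (gap cp t i \<omega>)\<bar> \<le> 2 * cp * B"
      using g(1) queue_path.gap_nonneg t(1) cp_pos by (intro mult_left_mono) auto
    then show "\<bar>2 * cp * \<bar>g (gap cp t i \<omega>)\<bar> + 2 * cp\<^sup>2\<bar> \<le> 2 * cp * B + 2 * cp\<^sup>2"
      using cp_pos by simp
  qed measurable
  have "E (\<lambda>\<omega>. \<psi> (gap cp t (Suc i) \<omega>)) - E (\<lambda>\<omega>. \<psi> (gap cp t i \<omega>)) =
      E (\<lambda>\<omega>. \<psi> (gap cp t (Suc i) \<omega>) - \<psi> (gap cp t i \<omega>))"
    using int_\<psi> by simp
  also have "\<dots> \<le> E (\<lambda>\<omega>.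
     of_bool (free_walks cp t i \<omega>) * (g (gap cp t i \<omega>) * free_increment cp t i \<omega>) +
     of_bool (free_walks cp t i \<omega>) * (h (gap cp t i \<omega>) * (free_increment cp t i \<omega>)\<^sup>2) +
     of_bool (merges cp t i \<omega>) * (2 * cp * \<bar>g (gap cp t i \<omega>)\<bar> + 2 * cp\<^sup>2))"
  proof (rule integral_mono_AE)
    show "AE \<omega> in P. \<psi> (gap cp t (Suc i) \<omega>) - \<psi> (gap cp t i \<omega>) \<le>
       of_bool (free_walks cp t i \<omega>) * (g (gap cp t i \<omega>) * free_increment cp t i \<omega>) +
       of_bool (free_walks cp t i \<omega>) * (h (gap cp t i \<omega>) * (free_increment cp t i \<omega>)\<^sup>2) +
       of_bool (merges cp t i \<omega>) * (2 * cp * \<bar>g (gap cp t i \<omega>)\<bar> + 2 * cp\<^sup>2)"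
      using AE_queue_path by eventually_elim (rule queue_path.gap_drift_le[OF _ t taylor h(1)])
  qed (use int_\<psi> mom_g(3) mom_h(4) int_m in \<open>auto intro!: Bochner_Integration.integrable_add Bochner_Integration.integrable_diff\<close>)
  also have "\<dots> = 2 * v * E (\<lambda>\<omega>. of_bool (free_walks cp t i \<omega>) * h (gap cp t i \<omega>)) +
           E (\<lambda>\<omega>. of_bool (merges cp t i \<omega>) * (2 * cp * \<bar>g (gap cp t i \<omega>)\<bar> + 2 * cp\<^sup>2))"
    using mom_g(1,3) mom_h(2,4) int_m by (subst Bochner_Integration.integral_add; (subst Bochner_Integration.integral_add)?; auto)
  finally show ?thesis .
qed

lemma expected_drift_sum_le:
  fixes \<psi> g h :: "real \<Rightarrow> real"
  assumes t: "t \<ge> 1" "real t * cm > real (J + 1) * cp"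
    and taylor: "\<And>d e. 0 \<le> d \<Longrightarrow> \<bar>e\<bar> \<le> cp \<Longrightarrow> \<psi> (d + e) \<le> \<psi> d + g d * e + h d * e\<^sup>2"
    and h: "\<And>d. \<bar>h d\<bar> \<le> 1" "h \<in> borel_measurable borel"
    and g: "\<And>d. 0 \<le> d \<Longrightarrow> \<bar>g d\<bar> \<le> B" "g \<in> borel_measurable borel"
    and \<psi>: "\<And>d. 0 \<le> d \<Longrightarrow> \<bar>\<psi> d\<bar> \<le> K * (1 + d)" "\<psi> \<in> borel_measurable borel"
  shows "E (\<lambda>\<omega>. \<psi> (gap cp t J \<omega>)) - E (\<lambda>\<omega>. \<psi> (gap cp t 0 \<omega>)) \<le>
    (\<Sum>i<J. 2 * v * E (\<lambda>\<omega>. of_bool (free_walks cp t i \<omega>) * h (gap cp t i \<omega>)) +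
           E (\<lambda>\<omega>. of_bool (merges cp t i \<omega>) * (2 * cp * \<bar>g (gap cp t i \<omega>)\<bar> + 2 * cp\<^sup>2)))"
proof -
  have "E (\<lambda>\<omega>. \<psi> (gap cp t J \<omega>)) - E (\<lambda>\<omega>. \<psi> (gap cp t 0 \<omega>)) =
      (\<Sum>i<J. E (\<lambda>\<omega>. \<psi> (gap cp t (Suc i) \<omega>)) - E (\<lambda>\<omega>. \<psi> (gap cp t i \<omega>)))"
    by (simp add: sum_lessThan_telescope[of "\<lambda>i. E (\<lambda>\<omega>. \<psi> (gap cp t i \<omega>))"])
  also have "\<dots> \<le> (\<Sum>i<J. 2 * v * E (\<lambda>\<omega>. of_bool (free_walks cp t i \<omega>) * h (gap cp t i \<omega>)) +
           E (\<lambda>\<omega>. of_bool (merges cp t i \<omega>) * (2 * cp * \<bar>g (gap cp t i \<omega>)\<bar> + 2 * cp\<^sup>2)))"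
  proof (rule sum_mono)
    fix i assume "i \<in> {..<J}"
    then have "real (i + 2) * cp \<le> real (J + 1) * cp" using cp_pos by (intro mult_right_mono) auto
    then have "real t * cm > real (i + 2) * cp" using t(2) by linarith
    from expected_drift_le[OF t(1) this taylor h g \<psi>]
    show "E (\<lambda>\<omega>. \<psi> (gap cp t (Suc i) \<omega>)) - E (\<lambda>\<omega>. \<psi> (gap cp t i \<omega>)) \<le>
        2 * v * E (\<lambda>\<omega>. of_bool (free_walks cp t i \<omega>) * h (gap cp t i \<omega>)) +
           E (\<lambda>\<omega>. of_bool (merges cp t i \<omega>) * (2 * cp * \<bar>g (gap cp t i \<omega>)\<bar> + 2 * cp\<^sup>2))" .
  qed
  finally show ?thesis .
qed

end

section \<open>The upper bound\<close>

context queue_model begin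

definition expected_reaches :: "nat \<Rightarrow> nat \<Rightarrow> real" where
  "expected_reaches i \<tau> = (\<Sum>t=1..\<tau>. E (\<lambda>\<omega>. of_bool (wave_reaches cp t i \<omega>)))"

lemma integrable_wave_reaches [intro]:
  assumes "t \<ge> 1" shows "integrable P (\<lambda>\<omega>. of_bool (wave_reaches cp t i \<omega>) :: real)"
proof (rule integrable_bounded[where B = 1])
  note measurable_queue(2)[OF assms, measurable]
  show "(\<lambda>\<omega>. of_bool (wave_reaches cp t i \<omega>) :: real) \<in> borel_measurable P" by measurable
qed simp

lemma integrable_merges [intro]:
  assumes "t \<ge> 1" shows "integrable P (\<lambda>\<omega>. of_bool (merges cp t i \<omega>) :: real)"
proof (rule integrable_bounded[where B = 1])
  note measurable_merges[OF assms, measurable]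
  show "(\<lambda>\<omega>. of_bool (merges cp t i \<omega>) :: real) \<in> borel_measurable P" by measurable
qed simp

lemma mean_wave_tail_eq: "mean_wave_tail cp \<mu> \<nu> j \<tau> = expected_reaches j \<tau> / real \<tau>"
proof -
  have "measure P {\<omega> \<in> space P. wave_length cp t \<omega> > enat j} = E (\<lambda>\<omega>. of_bool (wave_reaches cp t j \<omega>))"
    if "t \<ge> 1" for t
  proof -
    have "{\<omega> \<in> space P. wave_reaches cp t j \<omega>} \<in> sets P"
      using measurable_queue(2)[OF that, of j] by measurable
    then have "measure P {\<omega> \<in> space P. wave_reaches cp t j \<omega>} =
        E (\<lambda>\<omega>. indicator {\<omega> \<in> space P. wave_reaches cp t j \<omega>} \<omega>)"
      by simp
    also have "\<dots> = E (\<lambda>\<omega>. of_bool (wave_reaches cp t j \<omega>))"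
      by (intro Bochner_Integration.integral_cong) (auto simp: indicator_def)
    finally show ?thesis by (simp add: wave_length_greater_iff)
  qed
  then show ?thesis by (simp add: mean_wave_tail_def expected_reaches_def)
qed

lemma expected_reaches_antimono:
  assumes "i \<le> j" shows "expected_reaches j \<tau> \<le> expected_reaches i \<tau>"
  unfolding expected_reaches_def
  by (intro sum_mono Bochner_Integration.integral_mono integrable_wave_reaches)
     (use assms in \<open>auto intro: wave_reaches_antimono\<close>)

lemma expected_reaches_le: "expected_reaches i \<tau> \<le> real \<tau>"
proof -
  interpret P: prob_space P by (fact prob_P)
  have "expected_reaches i \<tau> \<le> (\<Sum>t=1..\<tau>. E (\<lambda>_. 1))"
    unfolding expected_reaches_def by (intro sum_mono Bochner_Integration.integral_mono integrable_wave_reaches) auto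
  then show ?thesis by (simp add: P.prob_space)
qed

lemma expected_merges_le:
  "(\<Sum>t=1..\<tau>. \<Sum>i=m..<J. E (\<lambda>\<omega>. of_bool (merges cp t i \<omega>))) \<le> 2 * expected_reaches m \<tau>"
proof -
  have "(\<Sum>t=1..\<tau>. \<Sum>i=m..<J. E (\<lambda>\<omega>. of_bool (merges cp t i \<omega>) :: real)) =
      E (\<lambda>\<omega>. \<Sum>t=1..\<tau>. \<Sum>i=m..<J. of_bool (merges cp t i \<omega>))"
    by (subst Bochner_Integration.integral_sum,
        intro Bochner_Integration.integrable_sum integrable_merges, simp,
        intro sum.cong[OF refl] Bochner_Integration.integral_sum[symmetric] integrable_merges, simp)
  also have "\<dots> \<le> E (\<lambda>\<omega>. 2 * (\<Sum>t=1..\<tau>. of_bool (wave_reaches cp t m \<omega>)))"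
    by (intro Bochner_Integration.integral_mono sum_merges_le Bochner_Integration.integrable_sum integrable_mult_right
        integrable_merges integrable_wave_reaches) simp_all
  also have "\<dots> = 2 * expected_reaches m \<tau>"
    unfolding expected_reaches_def by (subst integral_mult_right_zero, subst Bochner_Integration.integral_sum) auto
  finally show ?thesis .
qed

lemma expected_sum_gap:
  "(\<Sum>t=1..\<tau>. E (gap cp t i)) \<le> cp * (real \<tau> + real i)"
  "cm * real \<tau> - cp * real i \<le> (\<Sum>t=1..\<tau>. E (gap cp t i))"
proof -
  interpret P: prob_space P by (fact prob_P)
  have eq: "(\<Sum>t=1..\<tau>. E (gap cp t i)) = E (\<lambda>\<omega>. \<Sum>t=1..\<tau>. gap cp t i \<omega>)"
    using integrable_gap by (subst Bochner_Integration.integral_sum) auto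
  have int: "integrable P (\<lambda>\<omega>. \<Sum>t=1..\<tau>. gap cp t i \<omega>)" using integrable_gap by auto
  have "E (\<lambda>\<omega>. \<Sum>t=1..\<tau>. gap cp t i \<omega>) \<le> E (\<lambda>_. cp * (real \<tau> + real i))"
  proof (rule integral_mono_AE[OF int])
    show "AE \<omega> in P. (\<Sum>t=1..\<tau>. gap cp t i \<omega>) \<le> cp * (real \<tau> + real i)"
      using AE_queue_path by eventually_elim (rule queue_path.sum_gap_le)
  qed simp
  then show "(\<Sum>t=1..\<tau>. E (gap cp t i)) \<le> cp * (real \<tau> + real i)"
    unfolding eq by (simp add: P.prob_space)
  have "E (\<lambda>_. cm * real \<tau> - cp * real i) \<le> E (\<lambda>\<omega>. \<Sum>t=1..\<tau>. gap cp t i \<omega>)"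
  proof (rule integral_mono_AE[OF _ int])
    show "AE \<omega> in P. cm * real \<tau> - cp * real i \<le> (\<Sum>t=1..\<tau>. gap cp t i \<omega>)"
      using AE_queue_path by eventually_elim (rule queue_path.sum_gap_ge)
  qed simp
  then show "cm * real \<tau> - cp * real i \<le> (\<Sum>t=1..\<tau>. E (gap cp t i))"
    unfolding eq by (simp add: P.prob_space)
qed

lemma E_gap_nonneg:
  assumes "t \<ge> 1" shows "0 \<le> E (gap cp t i)"
proof (rule integral_nonneg_AE)
  show "AE \<omega> in P. 0 \<le> gap cp t i \<omega>"
    using AE_queue_path by eventually_elim (rule queue_path.gap_nonneg[OF _ assms])
qed

lemma E_gap_le:
  assumes "t \<ge> 1" shows "E (gap cp t i) \<le> real (Suc i) * cp"
proof -
  interpret P: prob_space P by (fact prob_P)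
  have "E (gap cp t i) \<le> E (\<lambda>_. real (Suc i) * cp)"
  proof (rule integral_mono_AE[OF integrable_gap[OF assms]])
    show "AE \<omega> in P. gap cp t i \<omega> \<le> real (Suc i) * cp"
      using AE_queue_path by eventually_elim (rule queue_path.gap_le[OF _ assms])
  qed simp
  then show ?thesis by (simp add: P.prob_space)
qed

text \<open>
  After this time the leaders at the ranks below \<open>J\<close> are random walks, by \<open>leader_pos\<close>. The earlier times
  contribute a bounded amount to each sum over time, which disappears in the averages.
\<close>

definition warmup :: "nat \<Rightarrow> nat" where
  "warmup J = nat \<lceil>real (J + 1) * cp / cm\<rceil>"

lemma warmup:
  assumes "t \<in> {Suc (warmup J)..\<tau>}"
  shows "t \<ge> 1" "real t * cm > real (J + 1) * cp"
proof -
  have "real t > real (J + 1) * cp / cm" using assms unfolding warmup_def by (auto simp: Suc_le_eq) linarith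
  then show "real t * cm > real (J + 1) * cp" using cm_pos by (simp add: field_simps)
qed (use assms in simp)

lemma sum_from_warmup_le:
  fixes f :: "nat \<Rightarrow> real"
  assumes "\<And>t. t \<ge> 1 \<Longrightarrow> 0 \<le> f t"
  shows "(\<Sum>t=Suc (warmup J)..\<tau>. f t) \<le> (\<Sum>t=1..\<tau>. f t)"
  using assms by (intro sum_mono2) auto

lemma sum_le_from_warmup:
  fixes f :: "nat \<Rightarrow> real"
  assumes "\<And>t. t \<ge> 1 \<Longrightarrow> f t \<le> c" "0 \<le> c"
  shows "(\<Sum>t=1..\<tau>. f t) \<le> real (warmup J) * c + (\<Sum>t=Suc (warmup J)..\<tau>. f t)"
proof -
  have "(\<Sum>t=1..\<tau>. f t) = (\<Sum>t\<in>{1..min \<tau> (warmup J)}. f t) + (\<Sum>t=Suc (warmup J)..\<tau>. f t)"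
    by (subst sum.union_disjoint[symmetric]) (auto intro!: sum.cong)
  moreover have "(\<Sum>t\<in>{1..min \<tau> (warmup J)}. f t) \<le> real (card {1..min \<tau> (warmup J)}) * c"
    using assms by (intro sum_bounded_above) auto
  moreover have "real (card {1..min \<tau> (warmup J)}) * c \<le> real (warmup J) * c"
    using assms by (intro mult_right_mono) auto
  ultimately show ?thesis by linarith
qed

abbreviation "upper_constant \<equiv> 12 * cp\<^sup>2 / v + 1"

text \<open>
  Concave test function with \<open>L\<close> of order \<open>sqrt J\<close>: the total decrease \<open>2 * v\<close> per column with a
  positive gap below \<open>L - cp\<close> is paid by the initial values, at most \<open>2 * L * cp\<close>, and by the bias of
  at most two merges per unit of time, at most \<open>5 * cp * L\<close> each.
\<close>

lemma small_gaps:
  assumes J: "J \<ge> 1" and L: "L = 2 * cp * sqrt (real J)" and v: "v > 0"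
  shows "(\<Sum>t=Suc (warmup J)..\<tau>. \<Sum>i<J. E (\<lambda>\<omega>. of_bool (free_walks cp t i \<omega>) * of_bool (gap cp t i \<omega> \<le> L - cp)))
    \<le> 12 * cp\<^sup>2 / v * sqrt (real J) * real \<tau>"
proof -
  interpret P: prob_space P by (fact prob_P)
  let ?I = "{Suc (warmup J)..\<tau>}"
  let ?S = "\<lambda>t i. E (\<lambda>\<omega>. of_bool (free_walks cp t i \<omega>) * of_bool (gap cp t i \<omega> \<le> L - cp))"
  let ?M = "\<lambda>t i. E (\<lambda>\<omega>. of_bool (merges cp t i \<omega>))"
  let ?c = "4 * cp * L + 2 * cp\<^sup>2"
  have "sqrt (real J) \<ge> 1" using J by simp
  then have cp_L: "2 * cp \<le> L" using cp_pos by (simp add: L)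
  then have L_pos: "L > 0" using cp_pos by simp
  have "cp * (2 * cp) \<le> cp * L" using cp_L cp_pos by (intro mult_left_mono) auto
  then have c: "?c \<le> 5 * cp * L" "0 \<le> ?c" using cp_pos L_pos by (auto simp: power2_eq_square)
  have step: "2 * v * (\<Sum>i<J. ?S t i) \<le> 2 * L * cp + ?c * (\<Sum>i<J. ?M t i)" if t: "t \<in> ?I" for t
  proof -
    note t' = warmup[OF t]
    define \<psi> where "\<psi> d = - (max (L - d) 0)\<^sup>2" for d
    have \<psi>_meas: "\<psi> \<in> borel_measurable borel" unfolding \<psi>_def[abs_def] by measurable
    have \<psi>_bound: "- L\<^sup>2 \<le> \<psi> d" "\<psi> d \<le> 0" if "0 \<le> d" for d
      using that L_pos by (auto simp: \<psi>_def intro!: power_mono)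
    have \<psi>_bound': "\<bar>\<psi> d\<bar> \<le> L\<^sup>2 * (1 + d)" if "0 \<le> d" for d
    proof -
      have "\<bar>\<psi> d\<bar> \<le> L\<^sup>2" using \<psi>_bound[OF that] by simp
      also have "\<dots> \<le> L\<^sup>2 * (1 + d)" using that mult_left_mono[of 1 "1 + d" "L\<^sup>2"] by simp
      finally show ?thesis .
    qed
    have int: "integrable P (\<lambda>\<omega>. \<psi> (gap cp t i \<omega>))" for i
      by (rule integrable_of_gap[OF t'(1) \<psi>_meas \<psi>_bound'])
    have "E (\<lambda>\<omega>. \<psi> (gap cp t J \<omega>)) - E (\<lambda>\<omega>. \<psi> (gap cp t 0 \<omega>)) \<le>
      (\<Sum>i<J. 2 * v * E (\<lambda>\<omega>. of_bool (free_walks cp t i \<omega>) * - of_bool (gap cp t i \<omega> \<le> L - cp)) +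
           E (\<lambda>\<omega>. of_bool (merges cp t i \<omega>) * (2 * cp * \<bar>2 * max (L - gap cp t i \<omega>) 0\<bar> + 2 * cp\<^sup>2)))"
    proof (rule expected_drift_sum_le[where B = "2 * L" and K = "L\<^sup>2"])
      show "\<psi> (d + e) \<le> \<psi> d + 2 * max (L - d) 0 * e + - of_bool (d \<le> L - cp) * e\<^sup>2"
        if "\<bar>e\<bar> \<le> cp" for d e
        unfolding \<psi>_def using that by (rule square_truncation_taylor)
    qed (use t' \<psi>_bound' \<psi>_meas L_pos in auto)
    also have "\<dots> \<le> (\<Sum>i<J. - (2 * v * ?S t i) + ?c * ?M t i)"
    proof (intro sum_mono add_mono)
      fix i
      show "E (\<lambda>\<omega>. of_bool (merges cp t i \<omega>) * (2 * cp * \<bar>2 * max (L - gap cp t i \<omega>) 0\<bar> + 2 * cp\<^sup>2)) \<le> ?c * ?M t i"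
      proof -
        have bound: "0 \<le> 2 * cp * \<bar>2 * max (L - gap cp t i \<omega>) 0\<bar> + 2 * cp\<^sup>2 \<and>
            2 * cp * \<bar>2 * max (L - gap cp t i \<omega>) 0\<bar> + 2 * cp\<^sup>2 \<le> ?c" if "queue_path cm cp \<omega>" for \<omega>
        proof -
          have "2 * cp * \<bar>2 * max (L - gap cp t i \<omega>) 0\<bar> \<le> 2 * cp * (2 * L)"
            using queue_path.gap_nonneg[OF that t'(1), of i] cp_pos L_pos by (intro mult_left_mono) auto
          then show ?thesis using cp_pos by simp
        qed
        have "E (\<lambda>\<omega>. of_bool (merges cp t i \<omega>) * (2 * cp * \<bar>2 * max (L - gap cp t i \<omega>) 0\<bar> + 2 * cp\<^sup>2))
            \<le> E (\<lambda>\<omega>. ?c * of_bool (merges cp t i \<omega>))"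
        proof (rule integral_mono_AE)
          show "integrable P (\<lambda>\<omega>. of_bool (merges cp t i \<omega>) * (2 * cp * \<bar>2 * max (L - gap cp t i \<omega>) 0\<bar> + 2 * cp\<^sup>2))"
          proof (rule integrable_merges_mult[OF t'(1), where B = ?c])
            fix \<omega> assume "queue_path cm cp \<omega>"
            from bound[OF this]
            show "\<bar>2 * cp * \<bar>2 * max (L - gap cp t i \<omega>) 0\<bar> + 2 * cp\<^sup>2\<bar> \<le> ?c" by linarith
          qed measurable
          show "AE \<omega> in P. of_bool (merges cp t i \<omega>) * (2 * cp * \<bar>2 * max (L - gap cp t i \<omega>) 0\<bar> + 2 * cp\<^sup>2) \<le> ?c * of_bool (merges cp t i \<omega>)"
            using AE_queue_path by eventually_elim (use bound in auto)
        qed (use t' in auto)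
        then show ?thesis by simp
      qed
    qed simp
    also have "\<dots> = - (2 * v * (\<Sum>i<J. ?S t i)) + ?c * (\<Sum>i<J. ?M t i)"
      by (simp only: sum.distrib sum_negf sum_distrib_left)
    finally have "2 * v * (\<Sum>i<J. ?S t i) \<le>
        E (\<lambda>\<omega>. \<psi> (gap cp t 0 \<omega>)) - E (\<lambda>\<omega>. \<psi> (gap cp t J \<omega>)) + ?c * (\<Sum>i<J. ?M t i)"
      by simp
    moreover have "E (\<lambda>\<omega>. \<psi> (gap cp t 0 \<omega>)) \<le> E (\<lambda>_. - (L - cp)\<^sup>2)"
    proof (rule integral_mono_AE[OF int])
      show "AE \<omega> in P. \<psi> (gap cp t 0 \<omega>) \<le> - (L - cp)\<^sup>2"
        using AE_queue_path
      proof eventually_elim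
        fix \<omega> assume "queue_path cm cp \<omega>"
        then have "gap cp t 0 \<omega> \<le> cp" using queue_path.gap_le[of cm cp \<omega> t 0] t' by simp
        then show "\<psi> (gap cp t 0 \<omega>) \<le> - (L - cp)\<^sup>2"
          using cp_L cp_pos by (auto simp: \<psi>_def intro!: power_mono)
      qed
    qed simp
    moreover have "E (\<lambda>_. - L\<^sup>2) \<le> E (\<lambda>\<omega>. \<psi> (gap cp t J \<omega>))"
      using AE_queue_path t' \<psi>_bound(1)
      by (intro integral_mono_AE[OF _ int]) (auto elim!: eventually_mono simp: queue_path.gap_nonneg)
    moreover have "L\<^sup>2 - (L - cp)\<^sup>2 \<le> 2 * L * cp" by (simp add: power2_eq_square algebra_simps)
    ultimately show ?thesis by (simp add: P.prob_space)
  qed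
  have "2 * v * (\<Sum>t\<in>?I. \<Sum>i<J. ?S t i) = (\<Sum>t\<in>?I. 2 * v * (\<Sum>i<J. ?S t i))"
    by (simp only: sum_distrib_left)
  also have "\<dots> \<le> (\<Sum>t\<in>?I. 2 * L * cp + ?c * (\<Sum>i<J. ?M t i))"
    by (intro sum_mono step)
  also have "\<dots> \<le> (\<Sum>t=1..\<tau>. 2 * L * cp + ?c * (\<Sum>i<J. ?M t i))"
    using c(2) L_pos cp_pos
    by (intro sum_from_warmup_le add_nonneg_nonneg mult_nonneg_nonneg sum_nonneg) auto
  also have "\<dots> = 2 * L * cp * real \<tau> + ?c * (\<Sum>t=1..\<tau>. \<Sum>i=0..<J. ?M t i)"
    by (simp add: sum.distrib sum_distrib_left lessThan_atLeast0)
  also have "\<dots> \<le> 2 * L * cp * real \<tau> + 5 * cp * L * (2 * real \<tau>)"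
  proof (intro add_left_mono mult_mono c(1))
    show "(\<Sum>t=1..\<tau>. \<Sum>i=0..<J. ?M t i) \<le> 2 * real \<tau>"
      using expected_merges_le[where \<tau> = \<tau> and m = 0 and J = J] expected_reaches_le[of 0 \<tau>] by linarith
  qed (use cp_pos L_pos in \<open>auto intro!: sum_nonneg\<close>)
  also have "\<dots> = 2 * v * (12 * cp\<^sup>2 / v * sqrt (real J) * real \<tau>)"
    using v by (simp add: L power2_eq_square field_simps)
  finally show ?thesis
    by (rule mult_left_le_imp_le) (use v in simp)
qed

text \<open>
  A wave reaching rank \<open>i\<close> has a small gap there, which is covered by \<open>small_gaps\<close>, or a gap of order
  \<open>sqrt J\<close>, which by Markov's inequality and the bounded mean gap has frequency \<open>O(1 / sqrt J)\<close> at each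
  of the \<open>J\<close> ranks.
\<close>

lemma sum_expected_reaches_le:
  assumes J: "J \<ge> 1" and v: "v > 0"
  shows "\<exists>R. \<forall>\<tau>. (\<Sum>i<J. expected_reaches i \<tau>) \<le> upper_constant * sqrt (real J) * real \<tau> + R"
proof -
  interpret P: prob_space P by (fact prob_P)
  define L where "L = 2 * cp * sqrt (real J)"
  have sqrt: "sqrt (real J) \<ge> 1" using J by simp
  then have L: "L - cp \<ge> cp * sqrt (real J)" "cp * sqrt (real J) > 0" using cp_pos by (auto simp: L_def)
  let ?S = "\<lambda>t i. E (\<lambda>\<omega>. of_bool (free_walks cp t i \<omega>) * of_bool (gap cp t i \<omega> \<le> L - cp))"
  let ?R = "\<lambda>t i. E (\<lambda>\<omega>. of_bool (wave_reaches cp t i \<omega>))"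
  have "(\<Sum>i<J. expected_reaches i \<tau>) \<le> upper_constant * sqrt (real J) * real \<tau> +
      (real (warmup J) * real J + sqrt (real J) * real J)" for \<tau>
  proof -
    let ?I = "{Suc (warmup J)..\<tau>}"
    \<comment> \<open>The quotient is Markov's bound for the event that the gap exceeds \<open>L - cp\<close>.\<close>
    have step: "?R t i \<le> ?S t i + E (gap cp t i) / (cp * sqrt (real J))" if t: "t \<in> ?I" and i: "i < J" for t i
    proof -
      note t' = warmup[OF t]
      have "real (i + 2) * cp \<le> real (J + 1) * cp" using i cp_pos by (intro mult_right_mono) auto
      then have t'': "real t * cm > real (i + 2) * cp" using t' by linarith
      have int: "integrable P (\<lambda>\<omega>. of_bool (free_walks cp t i \<omega>) * of_bool (gap cp t i \<omega> \<le> L - cp) :: real)"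
        using t'(1) by (intro free_increment_moments(5)[where B = 1]) auto
      have "?R t i \<le> E (\<lambda>\<omega>. of_bool (free_walks cp t i \<omega>) * of_bool (gap cp t i \<omega> \<le> L - cp) +
          gap cp t i \<omega> / (cp * sqrt (real J)))"
      proof (rule integral_mono_AE)
        show "AE \<omega> in P. of_bool (wave_reaches cp t i \<omega>) \<le>
          of_bool (free_walks cp t i \<omega>) * of_bool (gap cp t i \<omega> \<le> L - cp) + gap cp t i \<omega> / (cp * sqrt (real J))"
          using AE_queue_path
        proof eventually_elim
          fix \<omega> assume path: "queue_path cm cp \<omega>"
          have "1 \<le> gap cp t i \<omega> / (cp * sqrt (real J))" if "gap cp t i \<omega> > L - cp"
            using that L by simp
          moreover have "0 \<le> gap cp t i \<omega> / (cp * sqrt (real J))"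
            using queue_path.gap_nonneg[OF path t'(1), of i] L by simp
          ultimately show "of_bool (wave_reaches cp t i \<omega>) \<le>
            of_bool (free_walks cp t i \<omega>) * of_bool (gap cp t i \<omega> \<le> L - cp) + gap cp t i \<omega> / (cp * sqrt (real J))"
            using queue_path.leader_pos[OF path t'(1) t''] by (auto simp: free_walks_def)
        qed
      qed (use t' int integrable_gap in auto)
      also have "\<dots> = ?S t i + E (gap cp t i) / (cp * sqrt (real J))"
        using t' int integrable_gap by simp
      finally show ?thesis .
    qed
    have "(\<Sum>i<J. expected_reaches i \<tau>) = (\<Sum>t=1..\<tau>. \<Sum>i<J. ?R t i)"
      unfolding expected_reaches_def by (rule sum.swap)
    also have "\<dots> \<le> real (warmup J) * real J + (\<Sum>t\<in>?I. \<Sum>i<J. ?R t i)"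
    proof (rule sum_le_from_warmup)
      fix t :: nat assume t: "t \<ge> 1"
      have "?R t i \<le> E (\<lambda>_. 1)" for i
        by (rule Bochner_Integration.integral_mono[OF integrable_wave_reaches[OF t]]) auto
      then have "?R t i \<le> 1" for i by (simp add: P.prob_space)
      then show "(\<Sum>i<J. ?R t i) \<le> real J"
        using sum_bounded_above[of "{..<J}" "?R t" 1] by simp
    qed simp
    also have "(\<Sum>t\<in>?I. \<Sum>i<J. ?R t i) \<le> (\<Sum>t\<in>?I. \<Sum>i<J. ?S t i + E (gap cp t i) / (cp * sqrt (real J)))"
      by (intro sum_mono step) auto
    also have "\<dots> = (\<Sum>t\<in>?I. \<Sum>i<J. ?S t i) + (\<Sum>t\<in>?I. \<Sum>i<J. E (gap cp t i)) / (cp * sqrt (real J))"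
      by (simp only: sum.distrib sum_divide_distrib)
    also have "(\<Sum>t\<in>?I. \<Sum>i<J. ?S t i) \<le> 12 * cp\<^sup>2 / v * sqrt (real J) * real \<tau>"
      by (rule small_gaps[OF J L_def v])
    also have "(\<Sum>t\<in>?I. \<Sum>i<J. E (gap cp t i)) / (cp * sqrt (real J)) \<le> sqrt (real J) * (real \<tau> + real J)"
    proof -
      have "(\<Sum>t\<in>?I. \<Sum>i<J. E (gap cp t i)) \<le> (\<Sum>t=1..\<tau>. \<Sum>i<J. E (gap cp t i))"
        by (intro sum_from_warmup_le sum_nonneg E_gap_nonneg)
      also have "\<dots> = (\<Sum>i<J. \<Sum>t=1..\<tau>. E (gap cp t i))" by (rule sum.swap)
      also have "\<dots> \<le> (\<Sum>i<J. cp * (real \<tau> + real J))"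
        using cp_pos by (intro sum_mono order_trans[OF expected_sum_gap(1)] mult_left_mono) auto
      also have "\<dots> = (sqrt (real J) * (real \<tau> + real J)) * (cp * sqrt (real J))"
        by (simp add: algebra_simps)
      finally show ?thesis using L(2) by (simp add: divide_le_eq)
    qed
    finally show ?thesis by (simp add: algebra_simps)
  qed
  then show ?thesis by blast
qed

lemma expected_reaches_upper:
  assumes J: "J \<ge> 1" and v: "v > 0"
  shows "\<exists>R. \<forall>\<tau>. expected_reaches J \<tau> \<le> upper_constant / sqrt (real J) * real \<tau> + R"
proof -
  obtain R where R: "\<And>\<tau>. (\<Sum>i<J. expected_reaches i \<tau>) \<le> upper_constant * sqrt (real J) * real \<tau> + R"
    using sum_expected_reaches_le[OF assms] by blast
  have "expected_reaches J \<tau> \<le> upper_constant / sqrt (real J) * real \<tau> + R / real J" for \<tau>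
  proof -
    have "real J * expected_reaches J \<tau> \<le> (\<Sum>i<J. expected_reaches i \<tau>)"
      using sum_bounded_below[of "{..<J}" "expected_reaches J \<tau>" "\<lambda>i. expected_reaches i \<tau>"]
        expected_reaches_antimono by simp
    then have "expected_reaches J \<tau> \<le> (upper_constant * sqrt (real J) * real \<tau> + R) / real J"
      using R[of \<tau>] J by (simp add: pos_le_divide_eq mult.commute)
    also have "\<dots> = upper_constant * (sqrt (real J) / real J) * real \<tau> + R / real J"
      by (simp add: add_divide_distrib)
    also have "sqrt (real J) / real J = 1 / sqrt (real J)"
      by (simp add: sqrt_divide_self_eq inverse_eq_divide)
    finally show ?thesis by simp
  qed
  then show ?thesis by blast
qed

end

section \<open>The lower bound\<close>

context queue_model begin

text \<open>
  The slope of \<open>huber L\<close> at \<open>d\<close> is \<open>2 * min d L\<close>. At ranks below \<open>m\<close> the gap, hence the slope, is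
  bounded in terms of \<open>m\<close>, independently of \<open>L\<close>; only merges at ranks from \<open>m\<close> on are charged with a
  slope of order \<open>L\<close>.
\<close>

lemma expected_huber_gap_le:
  assumes t: "t \<in> {Suc (warmup j)..\<tau>}" and L: "L > 0"
  shows "E (\<lambda>\<omega>. huber L (gap cp t j \<omega>)) \<le>
    cp\<^sup>2 + 2 * v * (\<Sum>i<j. E (\<lambda>\<omega>. of_bool (wave_reaches cp t i \<omega>)))
     + (4 * cp\<^sup>2 * real m + 2 * cp\<^sup>2) * (\<Sum>i=0..<j. E (\<lambda>\<omega>. of_bool (merges cp t i \<omega>)))
     + (4 * cp * L + 2 * cp\<^sup>2) * (\<Sum>i=m..<j. E (\<lambda>\<omega>. of_bool (merges cp t i \<omega>)))"
proof -
  interpret P: prob_space P by (fact prob_P)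
  let ?R = "\<lambda>i. E (\<lambda>\<omega>. of_bool (wave_reaches cp t i \<omega>))"
  let ?M = "\<lambda>i. E (\<lambda>\<omega>. of_bool (merges cp t i \<omega>))"
  let ?c = "\<lambda>i. (4 * cp\<^sup>2 * real m + 2 * cp\<^sup>2) + of_bool (m \<le> i) * (4 * cp * L + 2 * cp\<^sup>2)"
  note t' = warmup[OF t]
  have v: "0 \<le> v" by (intro Bochner_Integration.integral_nonneg) auto
  have meas: "huber L \<in> borel_measurable borel" unfolding huber_def[abs_def] by measurable
  have bound: "\<bar>huber L d\<bar> \<le> 2 * L * (1 + d)" if "0 \<le> d" for d
    using abs_huber_le[OF that, of L] L by simp
  have int: "integrable P (\<lambda>\<omega>. huber L (gap cp t i \<omega>))" for i
    by (rule integrable_of_gap[OF t'(1) meas bound])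
  have "E (\<lambda>\<omega>. huber L (gap cp t j \<omega>)) - E (\<lambda>\<omega>. huber L (gap cp t 0 \<omega>)) \<le>
    (\<Sum>i<j. 2 * v * E (\<lambda>\<omega>. of_bool (free_walks cp t i \<omega>) * 1) +
      E (\<lambda>\<omega>. of_bool (merges cp t i \<omega>) * (2 * cp * \<bar>2 * min (gap cp t i \<omega>) L\<bar> + 2 * cp\<^sup>2)))"
  proof (rule expected_drift_sum_le[where B = "2 * L" and K = "2 * L"])
    show "huber L (d + e) \<le> huber L d + 2 * min d L * e + 1 * e\<^sup>2" for d e
      by (rule huber_taylor)
  qed (use t' L bound meas in auto)
  also have "\<dots> \<le> (\<Sum>i<j. 2 * v * ?R i + ?c i * ?M i)"
  proof (intro sum_mono add_mono)
    fix i
    show "2 * v * E (\<lambda>\<omega>. of_bool (free_walks cp t i \<omega>) * 1) \<le> 2 * v * ?R i"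
      using v t'(1) free_increment_moments(5)[OF t'(1), of "\<lambda>_. 1" 1 i]
      by (intro mult_left_mono Bochner_Integration.integral_mono) (auto simp: free_walks_def)
    have b: "0 \<le> 2 * cp * \<bar>2 * min (gap cp t i \<omega>) L\<bar> + 2 * cp\<^sup>2 \<and>
        2 * cp * \<bar>2 * min (gap cp t i \<omega>) L\<bar> + 2 * cp\<^sup>2 \<le> ?c i" if path: "queue_path cm cp \<omega>" for \<omega>
    proof -
      note gap = queue_path.gap_nonneg[OF path t'(1), of i] queue_path.gap_le[OF path t'(1), of i]
      define x where "x = 2 * cp * \<bar>2 * min (gap cp t i \<omega>) L\<bar>"
      have "0 \<le> x" using cp_pos by (simp add: x_def)
      have "x + 2 * cp\<^sup>2 \<le> ?c i"
      proof (cases "m \<le> i")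
        case True
        have "x \<le> 2 * cp * (2 * L)"
          unfolding x_def using gap(1) cp_pos L by (intro mult_left_mono) auto
        moreover have "?c i = 4 * cp\<^sup>2 * real m + 2 * cp\<^sup>2 + (4 * cp * L + 2 * cp\<^sup>2)"
          using True by simp
        moreover have "0 \<le> 4 * cp\<^sup>2 * real m" "0 \<le> cp\<^sup>2" by simp_all
        ultimately show ?thesis by linarith
      next
        case False
        then have "real (Suc i) * cp \<le> real m * cp" using cp_pos by (intro mult_right_mono) auto
        then have "gap cp t i \<omega> \<le> real m * cp" using gap(2) by (rule order_trans[rotated])
        then have "x \<le> 2 * cp * (2 * (real m * cp))"
          unfolding x_def using gap(1) cp_pos L by (intro mult_left_mono) auto
        moreover have "2 * cp * (2 * (real m * cp)) = 4 * cp\<^sup>2 * real m"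
          by (simp add: power2_eq_square)
        ultimately show ?thesis using False by simp
      qed
      then show ?thesis using \<open>0 \<le> x\<close> unfolding x_def by simp
    qed
    have "E (\<lambda>\<omega>. of_bool (merges cp t i \<omega>) * (2 * cp * \<bar>2 * min (gap cp t i \<omega>) L\<bar> + 2 * cp\<^sup>2))
        \<le> E (\<lambda>\<omega>. ?c i * of_bool (merges cp t i \<omega>))"
    proof (rule integral_mono_AE)
      show "integrable P (\<lambda>\<omega>. of_bool (merges cp t i \<omega>) * (2 * cp * \<bar>2 * min (gap cp t i \<omega>) L\<bar> + 2 * cp\<^sup>2))"
      proof (rule integrable_merges_mult[OF t'(1), where B = "?c i"])
        fix \<omega> assume "queue_path cm cp \<omega>"
        from b[OF this] show "\<bar>2 * cp * \<bar>2 * min (gap cp t i \<omega>) L\<bar> + 2 * cp\<^sup>2\<bar> \<le> ?c i" by linarith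
      qed measurable
      show "AE \<omega> in P. of_bool (merges cp t i \<omega>) * (2 * cp * \<bar>2 * min (gap cp t i \<omega>) L\<bar> + 2 * cp\<^sup>2)
          \<le> ?c i * of_bool (merges cp t i \<omega>)"
        using AE_queue_path by eventually_elim (use b in auto)
    qed (use t' in auto)
    then show "E (\<lambda>\<omega>. of_bool (merges cp t i \<omega>) * (2 * cp * \<bar>2 * min (gap cp t i \<omega>) L\<bar> + 2 * cp\<^sup>2)) \<le> ?c i * ?M i"
      by simp
  qed
  also have "\<dots> = 2 * v * (\<Sum>i<j. ?R i) + (4 * cp\<^sup>2 * real m + 2 * cp\<^sup>2) * (\<Sum>i<j. ?M i)
      + (4 * cp * L + 2 * cp\<^sup>2) * (\<Sum>i<j. of_bool (m \<le> i) * ?M i)"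
  proof -
    have "x + (a + w * b) * y = x + a * y + b * (w * y)" for x a w b y :: real
      by (simp add: algebra_simps)
    then have "(\<Sum>i<j. 2 * v * ?R i + ?c i * ?M i) =
        (\<Sum>i<j. 2 * v * ?R i + (4 * cp\<^sup>2 * real m + 2 * cp\<^sup>2) * ?M i
          + (4 * cp * L + 2 * cp\<^sup>2) * (of_bool (m \<le> i) * ?M i))"
      by (rule sum.cong[OF refl])
    then show ?thesis by (simp only: sum.distrib sum_distrib_left)
  qed
  also have "(\<Sum>i<j. of_bool (m \<le> i) * ?M i) = (\<Sum>i=m..<j. ?M i)"
    by (intro sum.mono_neutral_cong_right) auto
  finally have "E (\<lambda>\<omega>. huber L (gap cp t j \<omega>)) \<le> E (\<lambda>\<omega>. huber L (gap cp t 0 \<omega>)) +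
      (2 * v * (\<Sum>i<j. ?R i) + (4 * cp\<^sup>2 * real m + 2 * cp\<^sup>2) * (\<Sum>i<j. ?M i)
      + (4 * cp * L + 2 * cp\<^sup>2) * (\<Sum>i=m..<j. ?M i))"
    by simp
  moreover have "E (\<lambda>\<omega>. huber L (gap cp t 0 \<omega>)) \<le> E (\<lambda>_. cp\<^sup>2)"
  proof (rule integral_mono_AE[OF int])
    show "AE \<omega> in P. huber L (gap cp t 0 \<omega>) \<le> cp\<^sup>2"
      using AE_queue_path
    proof eventually_elim
      fix \<omega> assume path: "queue_path cm cp \<omega>"
      have "(gap cp t 0 \<omega>)\<^sup>2 \<le> cp\<^sup>2"
        using queue_path.gap_le[OF path t'(1), of 0] queue_path.gap_nonneg[OF path t'(1), of 0]
        by (intro power_mono) auto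
      then show "huber L (gap cp t 0 \<omega>) \<le> cp\<^sup>2"
        using huber_bounds(2)[OF queue_path.gap_nonneg[OF path t'(1), of 0], of L] L by linarith
    qed
  qed simp
  ultimately show ?thesis by (simp add: P.prob_space lessThan_atLeast0)
qed

text \<open>
  Gaps up to \<open>L\<close> are at most \<open>L\<close> and need the wave to reach \<open>j\<close>; larger gaps \<open>d\<close> satisfy
  \<open>L * d \<le> huber L d\<close>.
\<close>

lemma E_gap_le_huber:
  assumes t: "t \<ge> 1" and L: "L > 0"
  shows "E (gap cp t j) \<le> L * E (\<lambda>\<omega>. of_bool (wave_reaches cp t j \<omega>)) + E (\<lambda>\<omega>. huber L (gap cp t j \<omega>)) / L"
proof -
  have meas: "huber L \<in> borel_measurable borel" unfolding huber_def[abs_def] by measurable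
  have int: "integrable P (\<lambda>\<omega>. huber L (gap cp t j \<omega>))"
    using abs_huber_le[of _ L] L by (intro integrable_of_gap[OF t meas, where K = "2 * L"]) simp
  have "E (gap cp t j) \<le> E (\<lambda>\<omega>. L * of_bool (wave_reaches cp t j \<omega>) + huber L (gap cp t j \<omega>) / L)"
  proof (rule integral_mono_AE)
    show "AE \<omega> in P. gap cp t j \<omega> \<le> L * of_bool (wave_reaches cp t j \<omega>) + huber L (gap cp t j \<omega>) / L"
      using AE_queue_path
    proof eventually_elim
      fix \<omega> assume path: "queue_path cm cp \<omega>"
      note hb = huber_bounds[OF queue_path.gap_nonneg[OF path t, of j], of L]
      show "gap cp t j \<omega> \<le> L * of_bool (wave_reaches cp t j \<omega>) + huber L (gap cp t j \<omega>) / L"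
      proof (cases "wave_reaches cp t j \<omega>")
        case True
        have "gap cp t j \<omega> \<le> huber L (gap cp t j \<omega>) / L" if "gap cp t j \<omega> > L"
          using hb(4) that L by (simp add: pos_le_divide_eq mult.commute)
        moreover have "0 \<le> huber L (gap cp t j \<omega>) / L" using hb(1) L by simp
        ultimately show ?thesis using True L by (cases "gap cp t j \<omega> > L") auto
      next
        case False
        then show ?thesis using queue_path.gap_eq_0[OF path False t] hb(1) L by simp
      qed
    qed
  qed (intro integrable_gap t Bochner_Integration.integrable_add integrable_mult_right
        integrable_wave_reaches integrable_divide int)+
  also have "\<dots> = L * E (\<lambda>\<omega>. of_bool (wave_reaches cp t j \<omega>)) + E (\<lambda>\<omega>. huber L (gap cp t j \<omega>)) / L"
    by (subst Bochner_Integration.integral_add,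
        intro integrable_mult_right integrable_wave_reaches t, intro integrable_divide int, simp)
  finally show ?thesis .
qed

text \<open>
  The mean gap, at least \<open>cm\<close>, is split by \<open>E_gap_le_huber\<close>. The upper bound enters twice: it limits the number
  of columns in which variance accumulates, and the number of merges at ranks from \<open>m\<close> on.
\<close>

lemma expected_reaches_lower_aux:
  assumes j: "j \<ge> 1" and m: "m \<ge> 1" and L: "L > 0" and v: "v > 0"
  shows "\<exists>R. \<forall>\<tau>. cm * real \<tau> - R \<le> L * expected_reaches j \<tau> +
    (cp\<^sup>2 + 2 * v * upper_constant * sqrt (real j) + 2 * (4 * cp\<^sup>2 * real m + 2 * cp\<^sup>2)
      + 2 * (4 * cp * L + 2 * cp\<^sup>2) * (upper_constant / sqrt (real m))) / L * real \<tau>"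
proof -
  let ?C = upper_constant
  obtain R1 where R1: "\<And>\<tau>. (\<Sum>i<j. expected_reaches i \<tau>) \<le> ?C * sqrt (real j) * real \<tau> + R1"
    using sum_expected_reaches_le[OF j v] by blast
  obtain R2 where R2: "\<And>\<tau>. expected_reaches m \<tau> \<le> ?C / sqrt (real m) * real \<tau> + R2"
    using expected_reaches_upper[OF m v] by blast
  let ?a = "4 * cp\<^sup>2 * real m + 2 * cp\<^sup>2" and ?b = "4 * cp * L + 2 * cp\<^sup>2"
  have ab: "?a \<ge> 0" "?b \<ge> 0" using cp_pos L by auto
  let ?Q = "cp\<^sup>2 + 2 * v * ?C * sqrt (real j) + 2 * ?a + 2 * ?b * (?C / sqrt (real m))"
  let ?R' = "real (warmup j) * (real (Suc j) * cp) + cp * real j + (2 * v * R1 + 2 * ?b * R2) / L"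
  have "cm * real \<tau> - ?R' \<le> L * expected_reaches j \<tau> + ?Q / L * real \<tau>" for \<tau>
  proof -
    let ?I = "{Suc (warmup j)..\<tau>}"
    let ?R = "\<lambda>t i. E (\<lambda>\<omega>. of_bool (wave_reaches cp t i \<omega>))"
    let ?M = "\<lambda>t i. E (\<lambda>\<omega>. of_bool (merges cp t i \<omega>))"
    have R_nonneg: "0 \<le> ?R t i" for t i
      by (intro Bochner_Integration.integral_nonneg) simp
    have M_nonneg: "0 \<le> ?M t i" for t i
      by (intro Bochner_Integration.integral_nonneg) simp
    have "(\<Sum>t\<in>?I. E (\<lambda>\<omega>. huber L (gap cp t j \<omega>))) \<le>
      (\<Sum>t\<in>?I. cp\<^sup>2 + 2 * v * (\<Sum>i<j. ?R t i) + ?a * (\<Sum>i=0..<j. ?M t i) + ?b * (\<Sum>i=m..<j. ?M t i))"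
      by (intro sum_mono expected_huber_gap_le L)
    also have "\<dots> \<le> (\<Sum>t=1..\<tau>. cp\<^sup>2 + 2 * v * (\<Sum>i<j. ?R t i) + ?a * (\<Sum>i=0..<j. ?M t i) + ?b * (\<Sum>i=m..<j. ?M t i))"
      using v ab R_nonneg M_nonneg cp_pos L
      by (intro sum_from_warmup_le add_nonneg_nonneg mult_nonneg_nonneg sum_nonneg) auto
    also have "\<dots> = cp\<^sup>2 * real \<tau> + 2 * v * (\<Sum>t=1..\<tau>. \<Sum>i<j. ?R t i)
        + ?a * (\<Sum>t=1..\<tau>. \<Sum>i=0..<j. ?M t i) + ?b * (\<Sum>t=1..\<tau>. \<Sum>i=m..<j. ?M t i)"
      by (simp only: sum.distrib sum_distrib_left[symmetric] sum_constant card_atLeastAtMost) simp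
    also have "(\<Sum>t=1..\<tau>. \<Sum>i<j. ?R t i) = (\<Sum>i<j. expected_reaches i \<tau>)"
      unfolding expected_reaches_def by (rule sum.swap)
    also have "cp\<^sup>2 * real \<tau> + 2 * v * (\<Sum>i<j. expected_reaches i \<tau>)
        + ?a * (\<Sum>t=1..\<tau>. \<Sum>i=0..<j. ?M t i) + ?b * (\<Sum>t=1..\<tau>. \<Sum>i=m..<j. ?M t i)
      \<le> cp\<^sup>2 * real \<tau> + 2 * v * (?C * sqrt (real j) * real \<tau> + R1)
        + ?a * (2 * real \<tau>) + ?b * (2 * (?C / sqrt (real m) * real \<tau> + R2))"
    proof (intro add_mono mult_left_mono order_refl R1 ab)
      show "(\<Sum>t=1..\<tau>. \<Sum>i=0..<j. ?M t i) \<le> 2 * real \<tau>"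
        using expected_merges_le[where \<tau> = \<tau> and m = 0 and J = j] expected_reaches_le[of 0 \<tau>] by linarith
      show "(\<Sum>t=1..\<tau>. \<Sum>i=m..<j. ?M t i) \<le> 2 * (?C / sqrt (real m) * real \<tau> + R2)"
        by (rule order_trans[OF expected_merges_le mult_left_mono[OF R2]]) simp
    qed (simp, use v in linarith)
    also have "\<dots> = ?Q * real \<tau> + (2 * v * R1 + 2 * ?b * R2)"
      by (simp add: algebra_simps)
    finally have huber: "(\<Sum>t\<in>?I. E (\<lambda>\<omega>. huber L (gap cp t j \<omega>))) \<le> ?Q * real \<tau> + (2 * v * R1 + 2 * ?b * R2)" .
    have "cm * real \<tau> - cp * real j \<le> (\<Sum>t=1..\<tau>. E (gap cp t j))" by (rule expected_sum_gap)
    also have "\<dots> \<le> real (warmup j) * (real (Suc j) * cp) + (\<Sum>t\<in>?I. E (gap cp t j))"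
      using cp_pos by (intro sum_le_from_warmup E_gap_le) auto
    also have "(\<Sum>t\<in>?I. E (gap cp t j)) \<le> (\<Sum>t\<in>?I. L * ?R t j + E (\<lambda>\<omega>. huber L (gap cp t j \<omega>)) / L)"
      by (intro sum_mono E_gap_le_huber L) auto
    also have "\<dots> = L * (\<Sum>t\<in>?I. ?R t j) + (\<Sum>t\<in>?I. E (\<lambda>\<omega>. huber L (gap cp t j \<omega>))) / L"
      by (simp only: sum.distrib sum_distrib_left sum_divide_distrib)
    also have "\<dots> \<le> L * expected_reaches j \<tau> + (?Q * real \<tau> + (2 * v * R1 + 2 * ?b * R2)) / L"
      unfolding expected_reaches_def using L huber R_nonneg
      by (intro add_mono mult_left_mono divide_right_mono sum_from_warmup_le) auto
    also have "\<dots> = L * expected_reaches j \<tau> + ?Q / L * real \<tau> + (2 * v * R1 + 2 * ?b * R2) / L"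
    proof -
      have "x + (q * y + r) / L = x + q / L * y + r / L" for x q y r :: real
        by (simp add: add_divide_distrib)
      then show ?thesis .
    qed
    finally show ?thesis by linarith
  qed
  then show ?thesis by blast
qed

end

text \<open>
  With \<open>C\<close> the constant of the upper bound and \<open>m = cutoff_rank cm cp C\<close>, the late merges contribute
  \<open>8 * cp * C / sqrt m \<le> cm / 4\<close>.
\<close>

definition cutoff_rank :: "real \<Rightarrow> real \<Rightarrow> real \<Rightarrow> nat" where
  "cutoff_rank cm cp C = nat \<lceil>(32 * cp * C / cm)\<^sup>2\<rceil> + 1"

text \<open>
  With \<open>L = gap_scale cm cp v C * sqrt j\<close> the remaining terms, of order at most \<open>sqrt j\<close> before the
  division by \<open>L\<close>, contribute at most \<open>cm / 4\<close>.
\<close>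

definition gap_scale :: "real \<Rightarrow> real \<Rightarrow> real \<Rightarrow> real \<Rightarrow> real" where
  "gap_scale cm cp v C =
     max 1 (4 * (cp\<^sup>2 * (5 + 8 * real (cutoff_rank cm cp C)) + 2 * v * C + 4 * cp\<^sup>2 * C) / cm)"

context queue_model begin

lemma expected_reaches_lower:
  assumes j: "j \<ge> 1" and v: "v > 0"
  shows "\<exists>R. \<forall>\<tau>. cm / (2 * gap_scale cm cp v upper_constant) / sqrt (real j) * real \<tau> - R \<le> expected_reaches j \<tau>"
proof -
  define C where "C = upper_constant"
  define m where "m = cutoff_rank cm cp C"
  define K where "K = gap_scale cm cp v C"
  define s where "s = sqrt (real j)"
  define L where "L = K * s"
  have C: "C > 0" unfolding C_def using v by (intro add_nonneg_pos) auto
  have s: "s \<ge> 1" unfolding s_def using j by simp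
  have K: "K \<ge> 1" unfolding K_def gap_scale_def by simp
  have L: "L \<ge> K" "L > 0" using s K mult_left_mono[of 1 s K] unfolding L_def by auto
  have m: "m \<ge> 1" unfolding m_def cutoff_rank_def by simp
  have sm: "sqrt (real m) \<ge> 1" using m by simp
  have "32 * cp * C / cm \<le> sqrt (real m)"
    unfolding m_def cutoff_rank_def by (intro real_le_rsqrt) linarith
  then have "32 * cp * C \<le> cm * sqrt (real m)" using cm_pos by (simp add: field_simps)
  then have merge: "8 * cp * (C / sqrt (real m)) \<le> cm / 4" using sm by (simp add: field_simps)
  have "4 * (cp\<^sup>2 * (5 + 8 * real m) + 2 * v * C + 4 * cp\<^sup>2 * C) / cm \<le> K"
    unfolding K_def m_def gap_scale_def by simp
  then have K': "cp\<^sup>2 * (5 + 8 * real m) + 2 * v * C + 4 * cp\<^sup>2 * C \<le> cm / 4 * K"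
    using cm_pos by (simp add: field_simps)
  let ?Q = "cp\<^sup>2 + 2 * v * C * s + 2 * (4 * cp\<^sup>2 * real m + 2 * cp\<^sup>2)
      + 2 * (4 * cp * L + 2 * cp\<^sup>2) * (C / sqrt (real m))"
  have Q: "?Q \<le> cm / 2 * L"
  proof -
    have "4 * cp\<^sup>2 * (C / sqrt (real m)) \<le> 4 * cp\<^sup>2 * C"
      using sm C by (intro mult_left_mono) (auto simp: divide_le_eq)
    moreover have "8 * cp * L * (C / sqrt (real m)) \<le> cm / 4 * L"
      using mult_right_mono[OF merge, of L] L by (simp add: mult_ac)
    moreover have "cp\<^sup>2 * (5 + 8 * real m) + 4 * cp\<^sup>2 * C \<le> (cp\<^sup>2 * (5 + 8 * real m) + 4 * cp\<^sup>2 * C) * s"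
      using s C mult_left_mono[of 1 s "cp\<^sup>2 * (5 + 8 * real m) + 4 * cp\<^sup>2 * C"] by simp
    moreover have "(cp\<^sup>2 * (5 + 8 * real m) + 2 * v * C + 4 * cp\<^sup>2 * C) * s \<le> cm / 4 * L"
      using mult_right_mono[OF K', of s] s by (simp add: L_def mult_ac)
    moreover have "?Q = cp\<^sup>2 * (5 + 8 * real m) + 2 * v * C * s + 8 * cp * L * (C / sqrt (real m))
        + 4 * cp\<^sup>2 * (C / sqrt (real m))"
      by (simp add: algebra_simps)
    moreover have "cm / 4 * L + cm / 4 * L = cm / 2 * L" by simp
    ultimately show ?thesis unfolding distrib_right by linarith
  qed
  then have QL: "?Q / L \<le> cm / 2" using L by (simp add: divide_le_eq)
  obtain R where R: "\<And>\<tau>. cm * real \<tau> - R \<le> L * expected_reaches j \<tau> + ?Q / L * real \<tau>"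
    using expected_reaches_lower_aux[OF j m L(2) v] unfolding C_def[symmetric] s_def[symmetric] by blast
  have "cm / (2 * K) / s * real \<tau> - R / L \<le> expected_reaches j \<tau>" for \<tau>
  proof -
    have "?Q / L * real \<tau> \<le> cm / 2 * real \<tau>" using QL by (intro mult_right_mono) auto
    then have "cm / 2 * real \<tau> - R \<le> L * expected_reaches j \<tau>" using R[of \<tau>] by simp
    then have "(cm / 2 * real \<tau> - R) / L \<le> expected_reaches j \<tau>"
      using L by (simp add: divide_le_eq mult.commute)
    then show ?thesis by (simp add: diff_divide_distrib L_def)
  qed
  then show ?thesis unfolding K_def C_def s_def by blast
qed

lemma rho_upper_le:
  assumes "\<And>\<tau>. expected_reaches j \<tau> \<le> a * real \<tau> + R"
  shows "rho_upper cp \<mu> \<nu> j \<le> ereal a"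
proof -
  have lim: "(\<lambda>\<tau>. a + R / real \<tau>) \<longlonglongrightarrow> a"
    using tendsto_add[OF tendsto_const lim_const_over_n[of R], of a] by simp
  have "eventually (\<lambda>\<tau>. ereal (mean_wave_tail cp \<mu> \<nu> j \<tau>) \<le> ereal (a + R / real \<tau>)) sequentially"
    using eventually_gt_at_top[of 0]
  proof eventually_elim
    fix \<tau> :: nat assume \<tau>: "0 < \<tau>"
    have "expected_reaches j \<tau> / real \<tau> \<le> (a * real \<tau> + R) / real \<tau>"
      by (intro divide_right_mono assms) simp
    then show "ereal (mean_wave_tail cp \<mu> \<nu> j \<tau>) \<le> ereal (a + R / real \<tau>)"
      using \<tau> by (simp add: mean_wave_tail_eq add_divide_distrib)
  qed
  then have "rho_upper cp \<mu> \<nu> j \<le> limsup (\<lambda>\<tau>. ereal (a + R / real \<tau>))"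
    unfolding rho_upper_def by (rule Limsup_mono)
  also have "\<dots> = ereal a"
    using lim by (intro lim_imp_Limsup) auto
  finally show ?thesis .
qed

lemma rho_lower_ge:
  assumes "\<And>\<tau>. a * real \<tau> - R \<le> expected_reaches j \<tau>"
  shows "ereal a \<le> rho_lower cp \<mu> \<nu> j"
proof -
  have lim: "(\<lambda>\<tau>. a - R / real \<tau>) \<longlonglongrightarrow> a"
    using tendsto_diff[OF tendsto_const lim_const_over_n[of R], of a] by simp
  have "eventually (\<lambda>\<tau>. ereal (a - R / real \<tau>) \<le> ereal (mean_wave_tail cp \<mu> \<nu> j \<tau>)) sequentially"
    using eventually_gt_at_top[of 0]
  proof eventually_elim
    fix \<tau> :: nat assume \<tau>: "0 < \<tau>"
    have "(a * real \<tau> - R) / real \<tau> \<le> expected_reaches j \<tau> / real \<tau>"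
      by (intro divide_right_mono assms) simp
    then show "ereal (a - R / real \<tau>) \<le> ereal (mean_wave_tail cp \<mu> \<nu> j \<tau>)"
      using \<tau> by (simp add: mean_wave_tail_eq diff_divide_distrib)
  qed
  then have "liminf (\<lambda>\<tau>. ereal (a - R / real \<tau>)) \<le> rho_lower cp \<mu> \<nu> j"
    unfolding rho_lower_def by (rule Liminf_mono)
  moreover have "liminf (\<lambda>\<tau>. ereal (a - R / real \<tau>)) = ereal a"
    using lim by (intro lim_imp_Liminf) auto
  ultimately show ?thesis by simp
qed

end

section \<open>Wave lengths have tail of order one over the square root\<close>

theorem proposition2:
  fixes cm cp :: real and \<mu> :: "real measure"
  assumes "0 < cm" and "cm < cp"
    and "prob_space \<mu>" and "sets \<mu> = sets borel"
    and "AE x in \<mu>. x \<in> {cm..cp}"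
    and "prob_space.expectation \<mu> (\<lambda>x. x) = 1"
    and "prob_space.variance \<mu> (\<lambda>x. x) > 0"
  shows "\<exists>a_minus a_plus :: real. 0 < a_minus \<and> a_minus < a_plus \<and>
           (\<forall>\<nu>. initial_distribution cm cp \<nu> \<longrightarrow>
             (\<forall>j::nat. j \<ge> 1 \<longrightarrow>
               ereal (a_minus * real j powr (-1/2)) \<le> rho_lower cp \<mu> \<nu> j \<and>
               rho_lower cp \<mu> \<nu> j \<le> rho_upper cp \<mu> \<nu> j \<and>
               rho_upper cp \<mu> \<nu> j \<le> ereal (a_plus * real j powr (-1/2))))"
proof -
  define v where "v = prob_space.variance \<mu> (\<lambda>x. x)"
  define C where "C = 12 * cp\<^sup>2 / v + 1"
  define a where "a = cm / (2 * gap_scale cm cp v C)"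
  have v: "v > 0" using assms(7) by (simp add: v_def)
  have "gap_scale cm cp v C \<ge> 1" by (simp add: gap_scale_def)
  then have a: "a > 0" using assms(1) by (simp add: a_def)
  show ?thesis
  proof (rule exI[of _ a], rule exI[of _ "C + a"], intro conjI allI impI)
    show "0 < a" by (fact a)
    show "a < C + a" using v by (simp add: C_def add_nonneg_pos)
  next
    fix \<nu> :: "(nat \<Rightarrow> real) measure" and j :: nat
    assume \<nu>: "initial_distribution cm cp \<nu>" and j: "j \<ge> 1"
    interpret queue_model cm cp \<mu> \<nu>
      by (rule queue_model.intro; fact)
    have powr: "real j powr (-1/2) = 1 / sqrt (real j)"
      by (simp add: powr_minus_divide powr_half_sqrt)
    obtain R1 where "\<And>\<tau>. a / sqrt (real j) * real \<tau> - R1 \<le> expected_reaches j \<tau>"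
      using expected_reaches_lower[OF j assms(7)] unfolding a_def C_def v_def by blast
    then show "ereal (a * real j powr (-1/2)) \<le> rho_lower cp \<mu> \<nu> j"
      unfolding powr using rho_lower_ge[of "a / sqrt (real j)" R1 j] by simp
    show "rho_lower cp \<mu> \<nu> j \<le> rho_upper cp \<mu> \<nu> j"
      unfolding rho_lower_def rho_upper_def by (rule Liminf_le_Limsup) simp
    obtain R2 where "\<And>\<tau>. expected_reaches j \<tau> \<le> C / sqrt (real j) * real \<tau> + R2"
      using expected_reaches_upper[OF j assms(7)] unfolding C_def v_def by blast
    then have "rho_upper cp \<mu> \<nu> j \<le> ereal (C / sqrt (real j))"
      by (rule rho_upper_le)
    also have "\<dots> \<le> ereal ((C + a) * real j powr (-1/2))"
      unfolding powr using a by (simp add: divide_right_mono)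
    finally show "rho_upper cp \<mu> \<nu> j \<le> ereal ((C + a) * real j powr (-1/2))" .
  qed
qed

end
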